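(* Let $F(x,y,z)=c$ be a constant-rank elimination problem (CREP) whose input space $\mathcal X$, output space $\mathcal Y$ and latent space $\mathcal Z$ all have a Riemannian metric. At any solution $(x_0,y_0,z_0)$ of the CREP, we have $$\kappa_{x\mapsto y}[F](x_0,y_0,z_0)\le\kappa_{x\mapsto(y,z)}[F](x_0,y_0,z_0).$$
   Context: Constant-rank elimination problem (CREP): Let $F\colon\mathcal X\times\mathcal Y\times\mathcal Z\to\mathcal W$ be a smooth map, where $\mathcal X,\mathcal Y,\mathcal Z,\mathcal W$ are smooth manifolds, and let $c$ be a constant in the image of $F$. Let $DF$ be the total derivative of $F$. Suppose there are $r,k\in\mathbb N$ such that everywhere on $\mathcal X\times\mathcal Y\times\mathcal Z$ (i) $\operatorname{rank} DF(x,y,z)=\operatorname{rank}\frac{\partial}{\partial (y,z)}F(x,y,z)=r$, and (ii) $\operatorname{rank}\frac{\partial}{\partial z}F(x,y,z)=k$. Then the equation $F(x,y,z)=c$ is called a CREP. $\mathcal X,\mathcal Y,\mathcal Z$ are the input, output and latent space, respectively. Canonical solution map: Let $(x_0,y_0,z_0)$ be a solution of a CREP, where $\mathcal Y$ is Riemannian with distance $d_{\mathcal Y}$. For all sufficiently small neighbourhoods $\widehat{\mathcal Z}\subseteq\mathcal Z$ of $z_0$, the map $$H(x):=\operatorname*{arg\,min}_{y\,:\,\exists z\in\widehat{\mathcal Z},\ F(x,y,z)=c}d_{\mathcal Y}(y_0,y)$$ is well-defined and smooth for $x$ in a neighbourhood of $x_0$. Condition number: If $\mathcal X$ and $\mathcal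 Y$ are Riemannian with distances $d_{\mathcal X},d_{\mathcal Y}$, then, with $\widehat{\mathcal Z}$ a sufficiently small neighbourhood of $z_0$ in $\mathcal Z$ and $H$ the corresponding canonical solution map, $$\kappa_{x\mapsto y}[F](x_0,y_0,z_0):=\limsup_{x\to x_0}\frac{d_{\mathcal Y}(y_0,H(x))}{d_{\mathcal X}(x_0,x)}=\limsup_{x\to x_0}\min_{F(x,y,z)=c,\ z\in\widehat{\mathcal Z}}\frac{d_{\mathcal Y}(y_0,y)}{d_{\mathcal X}(x_0,x)}.$$ This does not depend on the choice of the (sufficiently small) $\widehat{\mathcal Z}$. The condition number $\kappa_{x\mapsto(y,z)}[F](x_0,y_0,z_0)$ is defined as the condition number of the output variable $(y,z)$ in the equivalent CREP with input space $\mathcal X$, output space $\mathcal Y\times\mathcal Z$ (with the product Riemannian metric and induced distance $d_{\mathcal Y\times\mathcal Z}$) and trivial latent space $\{0\}$, i.e. for $\overline F(x,(y,z),0):=F(x,y,z)$ with equation $\overline F = c$, at the solution $(x_0,(y_0,z_0),0)$. Explicitly, $$\kappa_{x\mapsto(y,z)}[F](x_0,y_0,z_0)=\limsup_{x\to x_0}\min_{(y,z)\in\mathcal Y\times\mathcal Z,\ F(x,y,z)=c}\frac{d_{\mathcal Y\times\mathcal Z}((y_0,z_0),(y,z))}{d_{\mathcal X}(x_0,x)}.$$ *)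

theory Defs
  imports "HOL-Analysis.Analysis"
begin

section \<open>Smooth maps between Euclidean spaces\<close>

text \<open>Charts take values in types of sort \<open>{real_inner, heine_borel}\<close>. These are exactly the
  finite-dimensional Euclidean spaces (see \<open>heine_borel_inner_finite_dim\<close> below). The library class
  \<open>euclidean_space\<close> is contained in this sort, but it excludes dimension 0, which must be allowed
  for the manifolds considered here. The sort is closed under products.\<close>

lemma heine_borel_inner_finite_dim:
  "\<exists>B :: 'a::{real_inner, heine_borel} set. finite B \<and> span B = UNIV"
proof (rule ccontr)
  assume "\<not> ?thesis"
  then have nospan: "span B \<noteq> UNIV" if "finite B" for B :: "'a set"
    using that by blast
  have step: "\<exists>v. norm v = 1 \<and> (\<forall>b\<in>B. b \<bullet> v = 0)"
    if B: "finite B" "\<And>b. b \<in> B \<Longrightarrow> norm b = 1"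
      "\<And>b c. b \<in> B \<Longrightarrow> c \<in> B \<Longrightarrow> b \<noteq> c \<Longrightarrow> b \<bullet> c = 0" for B :: "'a set"
  proof -
    obtain w where w: "w \<notin> span B"
      using nospan[OF B(1)] by blast
    define u where "u = w - (\<Sum>b\<in>B. (w \<bullet> b) *\<^sub>R b)"
    have "(\<Sum>b\<in>B. (w \<bullet> b) *\<^sub>R b) \<in> span B"
      by (intro span_sum span_scale span_base)
    then have u0: "u \<noteq> 0"
      using w unfolding u_def by auto
    have orth: "b \<bullet> u = 0" if "b \<in> B" for b
    proof -
      have "b \<bullet> (\<Sum>c\<in>B. (w \<bullet> c) *\<^sub>R c) = (\<Sum>c\<in>B. (w \<bullet> c) * (b \<bullet> c))"
        by (simp add: inner_sum_right)
      also have "\<dots> = (\<Sum>c\<in>B. if c = b then w \<bullet> b else 0)"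
        using B(2,3) \<open>b \<in> B\<close> by (intro sum.cong) (auto simp: dot_square_norm)
      also have "\<dots> = w \<bullet> b"
        using B(1) \<open>b \<in> B\<close> by simp
      finally show ?thesis
        by (simp add: u_def inner_diff_right inner_commute)
    qed
    show ?thesis
      by (rule exI[of _ "u /\<^sub>R norm u"]) (use u0 orth in auto)
  qed
  define P where "P B \<longleftrightarrow> finite B \<and> (\<forall>b\<in>B. norm b = 1) \<and> (\<forall>b\<in>B. \<forall>c\<in>B. b \<noteq> c \<longrightarrow> b \<bullet> c = 0)"
    for B :: "'a set"
  define Q where "Q B C \<longleftrightarrow> (\<exists>v. norm v = 1 \<and> (\<forall>b\<in>B. b \<bullet> v = 0) \<and> C = insert v B)"
    for B C :: "'a set"
  have "\<exists>f. \<forall>n::nat. P (f n) \<and> Q (f n) (f (Suc n))"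
  proof (rule dependent_nat_choice)
    show "\<exists>B. P B" by (rule exI[of _ "{}"]) (simp add: P_def)
    show "\<exists>C. P C \<and> Q B C" if "P B" for B and n :: nat
    proof -
      have "\<exists>v. norm v = 1 \<and> (\<forall>b\<in>B. b \<bullet> v = 0)"
        by (rule step) (use \<open>P B\<close> in \<open>simp_all add: P_def\<close>)
      then obtain v where v: "norm v = 1" "\<forall>b\<in>B. b \<bullet> v = 0"
        by blast
      then have "\<forall>b\<in>B. v \<bullet> b = 0"
        by (simp add: inner_commute)
      then have "P (insert v B)"
        using v \<open>P B\<close> unfolding P_def by simp
      moreover have "Q B (insert v B)"
        using v unfolding Q_def by blast
      ultimately show ?thesis by blast
    qed
  qed
  then obtain f where f: "\<And>n. P (f n)" "\<And>n. Q (f n) (f (Suc n))"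
    by blast
  obtain e where e: "\<And>n. norm (e n) = 1" "\<And>n b. b \<in> f n \<Longrightarrow> b \<bullet> e n = 0"
      "\<And>n. f (Suc n) = insert (e n) (f n)"
  proof -
    have "\<forall>n. \<exists>v. norm v = 1 \<and> (\<forall>b\<in>f n. b \<bullet> v = 0) \<and> f (Suc n) = insert v (f n)"
      using f(2) unfolding Q_def by blast
    from choice[OF this] show ?thesis
      using that by blast
  qed
  have mono: "f m \<subseteq> f n" if "m \<le> n" for m n
    using that by (rule lift_Suc_mono_le[rotated]) (auto simp: e(3))
  have orth: "e m \<bullet> e n = 0" if "m < n" for m n
    using mono[of "Suc m" n] that e(2)[of "e m" n] e(3)[of m] by auto
  have d: "dist (e m) (e n) \<ge> 1" if "m < n" for m n
  proof -
    have "(dist (e m) (e n))\<^sup>2 = 2"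
      using orth[OF that] e(1)[of m] e(1)[of n]
      by (simp add: dist_norm power2_norm_eq_inner inner_diff inner_commute norm_eq_1)
    then have "1\<^sup>2 \<le> (dist (e m) (e n))\<^sup>2"
      by simp
    then show ?thesis
      by (rule power2_le_imp_le) simp
  qed
  have "bounded (range e)"
    by (auto simp: bounded_iff e(1) intro!: exI[of _ 1])
  then obtain l r where r: "strict_mono r" "(e \<circ> r) \<longlonglongrightarrow> l"
    using bounded_imp_convergent_subsequence by blast
  then have "Cauchy (e \<circ> r)"
    by (simp add: LIMSEQ_imp_Cauchy)
  then obtain M where M: "\<forall>m\<ge>M. \<forall>n\<ge>M. dist ((e \<circ> r) m) ((e \<circ> r) n) < 1"
    unfolding Cauchy_def by (meson zero_less_one)
  have "dist (e (r M)) (e (r (Suc M))) < 1"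
    using M by simp
  moreover have "r M < r (Suc M)"
    using r(1) by (simp add: strict_mono_def)
  ultimately show False
    using d by (meson not_le)
qed

primrec Ck_on ::
  "nat \<Rightarrow> 'a::{real_inner, heine_borel} set \<Rightarrow> ('a \<Rightarrow> 'b::real_normed_vector) \<Rightarrow> bool"
where
  "Ck_on 0 S f \<longleftrightarrow> continuous_on S f"
| "Ck_on (Suc k) S f \<longleftrightarrow>
     (\<forall>x\<in>S. f differentiable (at x)) \<and> (\<forall>v. Ck_on k S (\<lambda>x. frechet_derivative f (at x) v))"

text \<open>Only used for open \<open>S\<close>, so that derivatives may be taken at \<open>at x\<close>.\<close>

definition smooth_on ::
  "'a::{real_inner, heine_borel} set \<Rightarrow> ('a \<Rightarrow> 'b::real_normed_vector) \<Rightarrow> bool"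
where
  "smooth_on S f \<longleftrightarrow> (\<forall>k. Ck_on k S f)"


section \<open>Smooth manifolds\<close>

text \<open>A chart is a pair of its domain and its coordinate map. The points of a manifold are the
  elements of a (Hausdorff, second-countable) type. Besides an atlas, a manifold carries for every
  point \<open>p\<close> a preferred chart \<open>chart_at p\<close> around \<open>p\<close>; its only purpose is to identify the tangent
  space at \<open>p\<close> with the model space: the vector \<open>v :: 'e\<close> stands for the tangent vector at \<open>p\<close> whose
  coordinates in \<open>chart_at p\<close> are \<open>v\<close>.\<close>

type_synonym ('a, 'e) chart = "'a set \<times> ('a \<Rightarrow> 'e)"

definition chart_inv :: "('a, 'e) chart \<Rightarrow> 'e \<Rightarrow> 'a" where
  "chart_inv \<phi> = inv_into (fst \<phi>) (snd \<phi>)"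

record ('a, 'e) manifold =
  atlas :: "('a, 'e) chart set"
  chart_at :: "'a \<Rightarrow> ('a, 'e) chart"

definition smooth_manifold ::
  "('a::{t2_space, second_countable_topology}, 'e::{real_inner, heine_borel}, 'm) manifold_scheme
    \<Rightarrow> bool"
where
  "smooth_manifold M \<longleftrightarrow>
     (\<forall>\<phi>\<in>atlas M. open (fst \<phi>) \<and> open (snd \<phi> ` fst \<phi>) \<and>
        homeomorphism (fst \<phi>) (snd \<phi> ` fst \<phi>) (snd \<phi>) (chart_inv \<phi>)) \<and>
     (\<forall>\<phi>\<in>atlas M. \<forall>\<psi>\<in>atlas M.
        smooth_on (snd \<phi> ` (fst \<phi> \<inter> fst \<psi>)) (snd \<psi> \<circ> chart_inv \<phi>)) \<and>
     (\<forall>p. chart_at M p \<in> atlas M \<and> p \<in> fst (chart_at M p))"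

definition smooth_map ::
  "('a::topological_space, 'e::{real_inner, heine_borel}, 'm) manifold_scheme \<Rightarrow>
   ('b::topological_space, 'f::{real_inner, heine_borel}, 'n) manifold_scheme \<Rightarrow>
   ('a \<Rightarrow> 'b) \<Rightarrow> bool"
where
  "smooth_map M N f \<longleftrightarrow> continuous_on UNIV f \<and>
     (\<forall>\<phi>\<in>atlas M. \<forall>\<psi>\<in>atlas N.
        smooth_on (snd \<phi> ` (fst \<phi> \<inter> f -` fst \<psi>)) (snd \<psi> \<circ> f \<circ> chart_inv \<phi>))"

definition tangent_map ::
  "('a, 'e::real_normed_vector, 'm) manifold_scheme \<Rightarrow>
   ('b, 'f::real_normed_vector, 'n) manifold_scheme \<Rightarrow> ('a \<Rightarrow> 'b) \<Rightarrow> 'a \<Rightarrow> 'e \<Rightarrow> 'f"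
where
  "tangent_map M N f p =
     frechet_derivative (snd (chart_at N (f p)) \<circ> f \<circ> chart_inv (chart_at M p))
       (at (snd (chart_at M p) p))"

definition rank_at ::
  "('a, 'e::real_normed_vector, 'm) manifold_scheme \<Rightarrow>
   ('b, 'f::real_normed_vector, 'n) manifold_scheme \<Rightarrow> ('a \<Rightarrow> 'b) \<Rightarrow> 'a \<Rightarrow> nat"
where
  "rank_at M N f p = dim (range (tangent_map M N f p))"

definition prod_chart :: "('a, 'e) chart \<Rightarrow> ('b, 'f) chart \<Rightarrow> ('a \<times> 'b, 'e \<times> 'f) chart" where
  "prod_chart \<phi> \<psi> = (fst \<phi> \<times> fst \<psi>, map_prod (snd \<phi>) (snd \<psi>))"

definition prod_manifold ::
  "('a, 'e, 'm) manifold_scheme \<Rightarrow> ('b, 'f, 'n) manifold_scheme \<Rightarrow>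
   ('a \<times> 'b, 'e \<times> 'f) manifold"
where
  "prod_manifold M N =
     \<lparr> atlas = {prod_chart \<phi> \<psi> | \<phi> \<psi>. \<phi> \<in> atlas M \<and> \<psi> \<in> atlas N},
       chart_at = (\<lambda>(p, q). prod_chart (chart_at M p) (chart_at N q)) \<rparr>"


section \<open>Riemannian manifolds\<close>

record ('a, 'e) riemannian = "('a, 'e) manifold" +
  metric :: "'a \<Rightarrow> 'e \<Rightarrow> 'e \<Rightarrow> real"

text \<open>\<open>metric M p u v\<close> takes tangent vectors at \<open>p\<close> in the coordinates of \<open>chart_at M p\<close>. For
  smoothness, the metric is expressed in an arbitrary chart \<open>\<phi>\<close>; the derivative of the transition
  from \<open>\<phi>\<close> to \<open>chart_at M p\<close> converts the coordinates of tangent vectors.\<close>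

definition riemannian_manifold ::
  "('a::{t2_space, second_countable_topology}, 'e::{real_inner, heine_borel}) riemannian \<Rightarrow> bool"
where
  "riemannian_manifold M \<longleftrightarrow> smooth_manifold M \<and>
     (\<forall>p. bilinear (metric M p) \<and> (\<forall>u v. metric M p u v = metric M p v u) \<and>
        (\<forall>u. u \<noteq> 0 \<longrightarrow> metric M p u u > 0)) \<and>
     (\<forall>\<phi>\<in>atlas M. \<forall>u v. smooth_on (snd \<phi> ` fst \<phi>)
        (\<lambda>a. let p = chart_inv \<phi> a;
                 T = frechet_derivative (snd (chart_at M p) \<circ> chart_inv \<phi>) (at a)
             in metric M p (T u) (T v)))"

definition prod_riemannian ::
  "('a, 'e) riemannian \<Rightarrow> ('b, 'f) riemannian \<Rightarrow> ('a \<times> 'b, 'e \<times> 'f) riemannian"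
where
  "prod_riemannian M N =
     \<lparr> atlas = atlas (prod_manifold M N),
       chart_at = chart_at (prod_manifold M N),
       metric = (\<lambda>(p, q) (u1, u2) (v1, v2). metric M p u1 v1 + metric N q u2 v2) \<rparr>"

definition C1_curve_on ::
  "('a::topological_space, 'e::real_normed_vector, 'm) manifold_scheme \<Rightarrow> real set \<Rightarrow>
   (real \<Rightarrow> 'a) \<Rightarrow> bool"
where
  "C1_curve_on M I \<gamma> \<longleftrightarrow> continuous_on I \<gamma> \<and>
     (\<forall>\<phi>\<in>atlas M. \<exists>D. continuous_on (I \<inter> \<gamma> -` fst \<phi>) D \<and>
        (\<forall>t \<in> I \<inter> \<gamma> -` fst \<phi>. ((snd \<phi> \<circ> \<gamma>) has_vector_derivative D t) (at t within I)))"

definition piecewise_C1_curve ::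
  "('a::topological_space, 'e::real_normed_vector, 'm) manifold_scheme \<Rightarrow> (real \<Rightarrow> 'a) \<Rightarrow> bool"
where
  "piecewise_C1_curve M \<gamma> \<longleftrightarrow>
     (\<exists>(n::nat) s. s 0 = 0 \<and> s n = 1 \<and>
        (\<forall>i<n. s i < s (Suc i) \<and> C1_curve_on M {s i..s (Suc i)} \<gamma>))"

text \<open>The integrand below is meaningful except at the finitely many break points of a piecewise
  \<open>C\<^sup>1\<close> curve, which do not affect the integral.\<close>

definition curve_length ::
  "('a, 'e::real_normed_vector) riemannian \<Rightarrow> (real \<Rightarrow> 'a) \<Rightarrow> ennreal"
where
  "curve_length M \<gamma> =
     (\<integral>\<^sup>+t\<in>{0..1}. (let v = vector_derivative (snd (chart_at M (\<gamma> t)) \<circ> \<gamma>) (at t)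
       in ennreal (sqrt (metric M (\<gamma> t) v v))) \<partial>lborel)"

text \<open>Manifolds need not be connected; the distance between distinct components is \<open>\<infinity>\<close>.\<close>

definition riemannian_dist ::
  "('a::topological_space, 'e::real_normed_vector) riemannian \<Rightarrow> 'a \<Rightarrow> 'a \<Rightarrow> ennreal"
where
  "riemannian_dist M p q =
     (INF \<gamma>\<in>{\<gamma>. piecewise_C1_curve M \<gamma> \<and> \<gamma> 0 = p \<and> \<gamma> 1 = q}. curve_length M \<gamma>)"


section \<open>Constant-rank elimination problems and their condition numbers\<close>

definition CREP ::
  "('x::{t2_space, second_countable_topology}, 'a::{real_inner, heine_borel}, 'm) manifold_scheme \<Rightarrow>
   ('y::{t2_space, second_countable_topology}, 'b::{real_inner, heine_borel}, 'n) manifold_scheme \<Rightarrow>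
   ('z::{t2_space, second_countable_topology}, 'd::{real_inner, heine_borel}, 'o) manifold_scheme \<Rightarrow>
   ('w::{t2_space, second_countable_topology}, 'e::{real_inner, heine_borel}, 'p) manifold_scheme \<Rightarrow>
   ('x \<times> 'y \<times> 'z \<Rightarrow> 'w) \<Rightarrow> 'w \<Rightarrow> bool"
where
  "CREP X Y Z W F c \<longleftrightarrow>
     smooth_manifold X \<and> smooth_manifold Y \<and> smooth_manifold Z \<and> smooth_manifold W \<and>
     smooth_map (prod_manifold X (prod_manifold Y Z)) W F \<and> c \<in> range F \<and>
     (\<exists>r k. \<forall>x y z.
        rank_at (prod_manifold X (prod_manifold Y Z)) W F (x, y, z) = r \<and>
        rank_at (prod_manifold Y Z) W (\<lambda>(y', z'). F (x, y', z')) (y, z) = r \<and>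
        rank_at Z W (\<lambda>z'. F (x, y, z')) z = k)"

text \<open>\<open>condition_number X Y F c x0 y0 Zh\<close> is the condition number of \<open>F (x, y, z) = c\<close> computed with
  the neighbourhood \<open>Zh\<close> of the latent variable, with the minimum written as an infimum in
  \<open>[0, \<infinity>]\<close>.\<close>

definition condition_number ::
  "('x::topological_space, 'a::real_normed_vector) riemannian \<Rightarrow>
   ('y::topological_space, 'b::real_normed_vector) riemannian \<Rightarrow>
   ('x \<times> 'y \<times> 'z \<Rightarrow> 'w) \<Rightarrow> 'w \<Rightarrow> 'x \<Rightarrow> 'y \<Rightarrow> 'z set \<Rightarrow> ennreal"
where
  "condition_number X Y F c x0 y0 Zh =
     Limsup (at x0) (\<lambda>x. INF y\<in>{y. \<exists>z\<in>Zh. F (x, y, z) = c}.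
       riemannian_dist Y y0 y / riemannian_dist X x0 x)"

text \<open>Whenever the canonical solution map \<open>H\<close> exists, the definition agrees with the one by \<open>H\<close>.\<close>

definition canonical_solution_at ::
  "('y::topological_space, 'b::real_normed_vector) riemannian \<Rightarrow>
   ('x \<times> 'y \<times> 'z \<Rightarrow> 'w) \<Rightarrow> 'w \<Rightarrow> 'y \<Rightarrow> 'z set \<Rightarrow> ('x \<Rightarrow> 'y) \<Rightarrow> 'x \<Rightarrow> bool"
where
  "canonical_solution_at Y F c y0 Zh H x \<longleftrightarrow>
     (\<forall>y. is_arg_min (riemannian_dist Y y0) (\<lambda>y. \<exists>z\<in>Zh. F (x, y, z) = c) y \<longleftrightarrow> y = H x)"

lemma condition_number_canonical_solution:
  assumes "eventually (canonical_solution_at Y F c y0 Zh H) (at x0)"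
  shows "condition_number X Y F c x0 y0 Zh =
    Limsup (at x0) (\<lambda>x. riemannian_dist Y y0 (H x) / riemannian_dist X x0 x)"
  unfolding condition_number_def
proof (rule Limsup_eq, rule eventually_mono[OF assms])
  fix x
  assume "canonical_solution_at Y F c y0 Zh H x"
  then have "is_arg_min (riemannian_dist Y y0) (\<lambda>y. \<exists>z\<in>Zh. F (x, y, z) = c) (H x)"
    unfolding canonical_solution_at_def by blast
  then show "(INF y\<in>{y. \<exists>z\<in>Zh. F (x, y, z) = c}.
      riemannian_dist Y y0 y / riemannian_dist X x0 x) =
    riemannian_dist Y y0 (H x) / riemannian_dist X x0 x"
    by (intro antisym INF_lower INF_greatest divide_right_mono_ennreal)
      (auto simp: is_arg_min_linorder)
qed

text \<open>The output variable is now \<open>(y, z)\<close> and the latent space is the one-point space, whose only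
  nonempty subset is \<open>{()}\<close>.\<close>

definition joint_condition_number ::
  "('x::topological_space, 'a::real_normed_vector) riemannian \<Rightarrow>
   ('y::topological_space, 'b::real_normed_vector) riemannian \<Rightarrow>
   ('z::topological_space, 'd::real_normed_vector) riemannian \<Rightarrow>
   ('x \<times> 'y \<times> 'z \<Rightarrow> 'w) \<Rightarrow> 'w \<Rightarrow> 'x \<Rightarrow> 'y \<Rightarrow> 'z \<Rightarrow> ennreal"
where
  "joint_condition_number X Y Z F c x0 y0 z0 =
     condition_number X (prod_riemannian Y Z) (\<lambda>(x, (y, z), u). F (x, y, z)) c x0 (y0, z0) {()}"

end

theory Submission
  imports Defs
begin

text \<open>A joint solution \<open>(y, z)\<close> of \<open>F (x, y, z) = c\<close> is in particular a solution \<open>y\<close> with latent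
  variable \<open>z\<close>, and projecting it to \<open>y\<close> does not increase its distance from the base point: the
  projection of a curve in \<open>Y \<times> Z\<close> to either factor is not longer than the curve
  (\<open>riemannian_dist_le_prod\<close>). The minimum for the output \<open>y\<close> would thus be bounded by the minimum
  for \<open>(y, z)\<close>, were it not for one mismatch: the former ranges only over solutions with
  \<open>z \<in> Zh\<close>, while the latter has no such restriction.

  The restriction turns out to be harmless near \<open>x0\<close>. If the joint condition number is infinite,
  nothing has to be shown. Otherwise fix a real \<open>k\<close> above it. For \<open>x\<close> near \<open>x0\<close>, the joint infimum is
  below \<open>k\<close>, so only joint solutions with \<open>d ((y0, z0), (y, z)) / d (x0, x) < k\<close> matter. These
  satisfy \<open>d (z0, z) < k * d (x0, x)\<close>, which tends to \<open>0\<close> as \<open>x\<close> tends to \<open>x0\<close>, and so their \<open>z\<close>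
  eventually lies in \<open>Zh\<close>. This bounds one infimum by the other for all
  \<open>x\<close> near \<open>x0\<close>, hence also their upper limits, and it does so for every neighbourhood \<open>Zh\<close> of \<open>z0\<close>.

  The last step compares the Riemannian distance with the topology in both directions: nearby points
  have small distance (\<open>riemannian_dist_small_nearby\<close>), and points outside a neighbourhood of \<open>p\<close> have
  distance from \<open>p\<close> bounded away from \<open>0\<close> (\<open>riemannian_dist_bounded_below_outside\<close>). Both follow
  since, over a compact ball in a chart, the norms given by the metric are uniformly equivalent to the
  Euclidean norm (\<open>metric_in_chart_equivalent_norm\<close>).\<close>


section \<open>Charts and their transition maps\<close>

lemma manifold_chartD:
  assumes "smooth_manifold M" "\<phi> \<in> atlas M"
  shows "open (fst \<phi>)" "open (snd \<phi> ` fst \<phi>)"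
    "homeomorphism (fst \<phi>) (snd \<phi> ` fst \<phi>) (snd \<phi>) (chart_inv \<phi>)"
    "\<And>p. p \<in> fst \<phi> \<Longrightarrow> chart_inv \<phi> (snd \<phi> p) = p"
proof -
  show h: "homeomorphism (fst \<phi>) (snd \<phi> ` fst \<phi>) (snd \<phi>) (chart_inv \<phi>)"
    using assms unfolding smooth_manifold_def by blast
  show "open (fst \<phi>)" "open (snd \<phi> ` fst \<phi>)"
    using assms unfolding smooth_manifold_def by blast+
  show "chart_inv \<phi> (snd \<phi> p) = p" if "p \<in> fst \<phi>" for p
    using h that by (simp add: homeomorphism_def)
qed

lemma chart_image_open:
  assumes "smooth_manifold M" "\<phi> \<in> atlas M" "open U"
  shows "open (snd \<phi> ` (fst \<phi> \<inter> U))"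
proof -
  note c = manifold_chartD[OF assms(1,2)]
  have "openin (top_of_set (snd \<phi> ` fst \<phi>)) (snd \<phi> ` (fst \<phi> \<inter> U))"
    by (rule homeomorphism_imp_open_map[OF c(3)]) (use assms(3) in \<open>auto simp: openin_open\<close>)
  then show ?thesis
    using c(2) openin_open_trans by blast
qed

lemma transition_derivative:
  assumes M: "smooth_manifold M" and \<phi>: "\<phi> \<in> atlas M" and \<psi>: "\<psi> \<in> atlas M"
  defines "A \<equiv> snd \<phi> ` (fst \<phi> \<inter> fst \<psi>)"
  shows "open A"
    and "a \<in> A \<Longrightarrow> ((snd \<psi> \<circ> chart_inv \<phi>) has_derivative
        frechet_derivative (snd \<psi> \<circ> chart_inv \<phi>) (at a)) (at a)"
    and "continuous_on A (\<lambda>a. frechet_derivative (snd \<psi> \<circ> chart_inv \<phi>) (at a) v)"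
proof -
  show "open A"
    unfolding A_def using chart_image_open[OF M \<phi>] manifold_chartD(1)[OF M \<psi>] by blast
  have "smooth_on A (snd \<psi> \<circ> chart_inv \<phi>)"
    using M \<phi> \<psi> unfolding smooth_manifold_def A_def by blast
  then have "Ck_on (Suc 0) A (snd \<psi> \<circ> chart_inv \<phi>)"
    unfolding smooth_on_def by blast
  then show "continuous_on A (\<lambda>a. frechet_derivative (snd \<psi> \<circ> chart_inv \<phi>) (at a) v)"
    and "a \<in> A \<Longrightarrow> ((snd \<psi> \<circ> chart_inv \<phi>) has_derivative
        frechet_derivative (snd \<psi> \<circ> chart_inv \<phi>) (at a)) (at a)"
    by (auto simp: frechet_derivative_works)
qed

text \<open>The reverse transition map is an inverse near \<open>a\<close>, so by the chain rule the derivative at \<open>a\<close>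
  has a left inverse.\<close>

lemma transition_derivative_nonzero:
  assumes M: "smooth_manifold M" and \<phi>: "\<phi> \<in> atlas M" and \<psi>: "\<psi> \<in> atlas M"
    and a: "a \<in> snd \<phi> ` (fst \<phi> \<inter> fst \<psi>)" and v: "v \<noteq> 0"
  shows "frechet_derivative (snd \<psi> \<circ> chart_inv \<phi>) (at a) v \<noteq> 0"
proof -
  let ?f = "snd \<psi> \<circ> chart_inv \<phi>" and ?g = "snd \<phi> \<circ> chart_inv \<psi>"
  obtain p where p: "p \<in> fst \<phi>" "p \<in> fst \<psi>" "a = snd \<phi> p"
    using a by blast
  have fa: "?f a = snd \<psi> p"
    using p manifold_chartD(4)[OF M \<phi>] by simp
  have df: "(?f has_derivative frechet_derivative ?f (at a)) (at a)"
    using transition_derivative(2)[OF M \<phi> \<psi> a] .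
  have dg: "(?g has_derivative frechet_derivative ?g (at (?f a))) (at (?f a))"
    by (rule transition_derivative(2)[OF M \<psi> \<phi>]) (use p fa in auto)
  have "((?g \<circ> ?f) has_derivative
      (frechet_derivative ?g (at (?f a)) \<circ> frechet_derivative ?f (at a))) (at a)"
    by (rule diff_chain_at[OF df dg])
  moreover have "((?g \<circ> ?f) has_derivative id) (at a)"
  proof (rule has_derivative_transform_within_open[OF has_derivative_id
        transition_derivative(1)[OF M \<phi> \<psi>] a])
    fix b assume "b \<in> snd \<phi> ` (fst \<phi> \<inter> fst \<psi>)"
    then show "id b = (?g \<circ> ?f) b"
      using manifold_chartD(4)[OF M \<phi>] manifold_chartD(4)[OF M \<psi>] by auto
  qed
  ultimately have "frechet_derivative ?g (at (?f a)) \<circ> frechet_derivative ?f (at a) = id"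
    by (rule has_derivative_unique)
  then have "frechet_derivative ?g (at (?f a)) (frechet_derivative ?f (at a) v) = v"
    by (metis comp_apply id_apply)
  moreover have "frechet_derivative ?g (at (?f a)) 0 = 0"
    using dg has_derivative_linear linear_0 by blast
  ultimately show ?thesis
    using v by force
qed

section \<open>The metric in a fixed chart\<close>

text \<open>These are the functions of \<open>a\<close> that a Riemannian metric requires to be smooth.\<close>

definition metric_in_chart ::
  "('a, 'e::real_normed_vector) riemannian \<Rightarrow> ('a, 'e) chart \<Rightarrow> 'e \<Rightarrow> 'e \<Rightarrow> 'e \<Rightarrow> real"
where
  "metric_in_chart M \<phi> a u v =
     (let p = chart_inv \<phi> a;
          T = frechet_derivative (snd (chart_at M p) \<circ> chart_inv \<phi>) (at a)
      in metric M p (T u) (T v))"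

lemma riemannian_manifoldD:
  assumes "riemannian_manifold M"
  shows "smooth_manifold M" "bilinear (metric M p)" "u \<noteq> 0 \<Longrightarrow> metric M p u u > 0"
    "metric M p u u \<ge> 0"
    "\<And>p. chart_at M p \<in> atlas M" "\<And>p. p \<in> fst (chart_at M p)"
proof -
  show b: "bilinear (metric M p)"
    using assms unfolding riemannian_manifold_def by blast
  show pos: "metric M p u u > 0" if "u \<noteq> 0" for u
    using assms that unfolding riemannian_manifold_def by blast
  show "metric M p u u \<ge> 0"
    using pos bilinear_lzero[OF b] by (cases "u = 0") (auto simp: less_imp_le)
  show M: "smooth_manifold M"
    using assms by (simp add: riemannian_manifold_def)
  show "\<And>p. chart_at M p \<in> atlas M" "\<And>p. p \<in> fst (chart_at M p)"
    using M by (simp_all add: smooth_manifold_def)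
qed

lemma metric_in_chart:
  assumes M: "riemannian_manifold M" and \<phi>: "\<phi> \<in> atlas M" and a: "a \<in> snd \<phi> ` fst \<phi>"
  shows metric_in_chart_bilinear: "bilinear (metric_in_chart M \<phi> a)"
    and metric_in_chart_pos: "u \<noteq> 0 \<Longrightarrow> metric_in_chart M \<phi> a u u > 0"
proof -
  note D = riemannian_manifoldD[OF M]
  define p where "p = chart_inv \<phi> a"
  let ?T = "frechet_derivative (snd (chart_at M p) \<circ> chart_inv \<phi>) (at a)"
  have p: "p \<in> fst \<phi>" "a = snd \<phi> p"
    using a manifold_chartD(4)[OF D(1) \<phi>] unfolding p_def by auto
  have a': "a \<in> snd \<phi> ` (fst \<phi> \<inter> fst (chart_at M p))"
    using p D(6) by blast
  have eq: "metric_in_chart M \<phi> a = (\<lambda>u v. metric M p (?T u) (?T v))"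
    unfolding metric_in_chart_def Let_def p_def ..
  have T: "linear ?T"
    using transition_derivative(2)[OF D(1) \<phi> D(5) a'] has_derivative_linear by blast
  show "bilinear (metric_in_chart M \<phi> a)"
    unfolding eq bilinear_def
  proof (intro conjI allI)
    show "linear (\<lambda>v. metric M p (?T u) (?T v))" for u
      using linear_compose[OF T, of "metric M p (?T u)"] D(2)[of p]
      by (simp add: bilinear_def o_def)
    show "linear (\<lambda>u. metric M p (?T u) (?T v))" for v
      using linear_compose[OF T, of "\<lambda>u. metric M p u (?T v)"] D(2)[of p]
      by (simp add: bilinear_def o_def)
  qed
  show "u \<noteq> 0 \<Longrightarrow> metric_in_chart M \<phi> a u u > 0"
    unfolding eq using D(3) transition_derivative_nonzero[OF D(1) \<phi> D(5) a'] by blast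
qed

text \<open>The constant \<open>Basis\<close> belongs to the class \<open>euclidean_space\<close>, which excludes dimension 0. Here
  the basis may be empty.\<close>

lemma finite_orthonormal_basis:
  obtains B :: "'a::{real_inner, heine_borel} set"
  where "finite B" "\<And>w. w = (\<Sum>b\<in>B. (w \<bullet> b) *\<^sub>R b)"
proof -
  obtain B0 :: "'a set" where B0: "finite B0" "span B0 = UNIV"
    using heine_borel_inner_finite_dim by blast
  obtain C where C: "finite C" "span C = span B0" "pairwise orthogonal C"
    using basis_orthogonal[OF B0(1)] by blast
  define B where "B = (\<lambda>c. c /\<^sub>R norm c) ` (C - {0})"
  have fin: "finite B"
    using C(1) by (simp add: B_def)
  have norm1: "b \<bullet> b = 1" if "b \<in> B" for b
    using that unfolding norm_eq_1[symmetric] B_def by (auto simp del: left_inverse intro!: left_inverse)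
  have orth: "b \<bullet> b' = 0" if "b \<in> B" "b' \<in> B" "b \<noteq> b'" for b b'
  proof -
    obtain c c' where c: "c \<in> C" "c' \<in> C" "b = c /\<^sub>R norm c" "b' = c' /\<^sub>R norm c'"
      using \<open>b \<in> B\<close> \<open>b' \<in> B\<close> by (auto simp: B_def)
    with \<open>b \<noteq> b'\<close> have "c \<noteq> c'" by auto
    with c C(3) have "c \<bullet> c' = 0" by (simp add: pairwise_def orthogonal_def)
    then show ?thesis using c by simp
  qed
  have "C \<subseteq> span B"
  proof
    fix c assume c: "c \<in> C"
    show "c \<in> span B"
    proof (cases "c = 0")
      case False
      then have "norm c *\<^sub>R (c /\<^sub>R norm c) \<in> span B"
        using c by (intro span_scale span_base) (auto simp: B_def)
      then show ?thesis using False by simp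
    qed (simp add: span_zero)
  qed
  then have sp: "span B = UNIV"
    using C(2) B0(2) span_mono[of C "span B"] by (auto simp: span_span)
  have "w = (\<Sum>b\<in>B. (w \<bullet> b) *\<^sub>R b)" for w
  proof -
    have "w \<in> span B" using sp by simp
    then show ?thesis
    proof (induction rule: span_induct_alt)
      case base
      then show ?case by simp
    next
      case (step c x y)
      have "(\<Sum>b\<in>B. (x \<bullet> b) *\<^sub>R b) = (\<Sum>b\<in>B. if b = x then x else 0)"
        using orth norm1 step(1) by (intro sum.cong) auto
      also have "\<dots> = x"
        using fin step(1) by simp
      finally have x: "(\<Sum>b\<in>B. (x \<bullet> b) *\<^sub>R b) = x" .
      have "(\<Sum>b\<in>B. ((c *\<^sub>R x + y) \<bullet> b) *\<^sub>R b) =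
          c *\<^sub>R (\<Sum>b\<in>B. (x \<bullet> b) *\<^sub>R b) + (\<Sum>b\<in>B. (y \<bullet> b) *\<^sub>R b)"
        by (simp add: inner_add_left scaleR_add_left sum.distrib scaleR_sum_right)
      then show ?case
        using x step(2) by simp
    qed
  qed
  then show ?thesis by (rule that[OF fin])
qed

text \<open>Smoothness of a Riemannian metric is a condition for each fixed pair of vectors. Expanding
  the argument in a finite basis turns this into continuity jointly in the point and the vector.\<close>

lemma metric_in_chart_continuous:
  fixes M :: "('p::{t2_space, second_countable_topology}, 'e::{real_inner, heine_borel}) riemannian"
  assumes M: "riemannian_manifold M" and \<phi>: "\<phi> \<in> atlas M"
  shows "continuous_on ((snd \<phi> ` fst \<phi>) \<times> UNIV) (\<lambda>(a, w). metric_in_chart M \<phi> a w w)"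
proof -
  let ?S = "snd \<phi> ` fst \<phi>"
  obtain B :: "'e set" where B: "finite B" "\<And>w. w = (\<Sum>b\<in>B. (w \<bullet> b) *\<^sub>R b)"
    using finite_orthonormal_basis[where 'a = 'e] by metis
  have "smooth_on ?S (\<lambda>a. metric_in_chart M \<phi> a u v)" for u v
    using M \<phi> by (simp add: riemannian_manifold_def metric_in_chart_def)
  then have "Ck_on 0 ?S (\<lambda>a. metric_in_chart M \<phi> a u v)" for u v
    unfolding smooth_on_def by blast
  then have cont: "continuous_on ?S (\<lambda>a. metric_in_chart M \<phi> a u v)" for u v
    by simp
  have expand: "metric_in_chart M \<phi> a w w =
      (\<Sum>(b, b')\<in>B \<times> B. (w \<bullet> b) * (w \<bullet> b') * metric_in_chart M \<phi> a b b')" if "a \<in> ?S" for a w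
  proof -
    note bil = metric_in_chart_bilinear[OF M \<phi> that]
    have "metric_in_chart M \<phi> a w w =
        metric_in_chart M \<phi> a (\<Sum>b\<in>B. (w \<bullet> b) *\<^sub>R b) (\<Sum>b\<in>B. (w \<bullet> b) *\<^sub>R b)"
      using B(2)[of w] by simp
    also have "\<dots> = (\<Sum>(b, b')\<in>B \<times> B.
        metric_in_chart M \<phi> a ((w \<bullet> b) *\<^sub>R b) ((w \<bullet> b') *\<^sub>R b'))"
      by (rule bilinear_sum[OF bil])
    finally show ?thesis
      by (simp add: bilinear_lmul[OF bil] bilinear_rmul[OF bil] mult.assoc mult.left_commute)
  qed
  have "continuous_on (?S \<times> UNIV) (\<lambda>x. metric_in_chart M \<phi> (fst x) b b')" for b b'
    by (rule continuous_on_compose2[OF cont]) (auto intro: continuous_intros)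
  then have "continuous_on (?S \<times> UNIV) (\<lambda>x. \<Sum>(b, b')\<in>B \<times> B.
      (snd x \<bullet> b) * (snd x \<bullet> b') * metric_in_chart M \<phi> (fst x) b b')"
    unfolding case_prod_beta by (intro continuous_intros)
  then show ?thesis
    by (rule continuous_on_eq) (auto simp: expand)
qed

text \<open>By homogeneity only unit vectors matter, and there the norm given by the metric is a positive
  continuous function on the compact set \<open>K \<times> sphere 0 1\<close>, so it has positive bounds on both sides.\<close>

lemma metric_in_chart_equivalent_norm:
  fixes M :: "('p::{t2_space, second_countable_topology}, 'e::{real_inner, heine_borel}) riemannian"
  assumes M: "riemannian_manifold M" and \<phi>: "\<phi> \<in> atlas M"
    and K: "compact K" "K \<subseteq> snd \<phi> ` fst \<phi>"
  obtains m C where "0 < m" "0 < C"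
    "\<And>a w. a \<in> K \<Longrightarrow> m * norm w \<le> sqrt (metric_in_chart M \<phi> a w w)"
    "\<And>a w. a \<in> K \<Longrightarrow> sqrt (metric_in_chart M \<phi> a w w) \<le> C * norm w"
proof -
  let ?A = "K \<times> sphere (0 :: 'e) 1" and ?h = "\<lambda>(a, w). sqrt (metric_in_chart M \<phi> a w w)"
  have "closed {w :: 'e. norm w = 1}"
    by (intro closed_Collect_eq continuous_intros)
  moreover have "sphere (0 :: 'e) 1 = {w. norm w = 1}"
    by auto
  moreover have "bounded (sphere (0 :: 'e) 1)"
    by (auto simp: bounded_iff)
  ultimately have "compact (sphere (0 :: 'e) 1)"
    by (simp add: compact_eq_bounded_closed)
  then have A: "compact ?A"
    using K(1) by (intro compact_Times)
  have "continuous_on ?A (\<lambda>x. case x of (a, w) \<Rightarrow> metric_in_chart M \<phi> a w w)"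
    by (rule continuous_on_subset[OF metric_in_chart_continuous[OF M \<phi>]]) (use K(2) in auto)
  then have h: "continuous_on ?A ?h"
    unfolding case_prod_beta by (intro continuous_intros)
  have pos: "?h x > 0" if "x \<in> ?A" for x
  proof -
    obtain b w where x: "x = (b, w)" by (cases x)
    then have "b \<in> snd \<phi> ` fst \<phi>" "w \<noteq> 0"
      using that K(2) by auto
    then show ?thesis
      using metric_in_chart_pos[OF M \<phi>] x by simp
  qed
  have "\<exists>m C. 0 < m \<and> 0 < C \<and> (\<forall>x\<in>?A. m \<le> ?h x \<and> ?h x \<le> C)"
  \<comment> \<open>Besides \<open>K = {}\<close>, this covers a zero-dimensional model space, whose unit sphere is empty.\<close>
  proof (cases "?A = {}")
    case True
    then show ?thesis by (intro exI[of _ 1]) auto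
  next
    case False
    obtain x where x: "x \<in> ?A" "\<And>y. y \<in> ?A \<Longrightarrow> ?h x \<le> ?h y"
      using continuous_attains_inf[OF A False h] by blast
    obtain x' where x': "x' \<in> ?A" "\<And>y. y \<in> ?A \<Longrightarrow> ?h y \<le> ?h x'"
      using continuous_attains_sup[OF A False h] by blast
    show ?thesis
      using pos[OF x(1)] pos[OF x'(1)] x(2) x'(2) by blast
  qed
  then obtain m C where mC: "0 < m" "0 < C" "\<And>x. x \<in> ?A \<Longrightarrow> m \<le> ?h x \<and> ?h x \<le> C"
    by blast
  have "m * norm w \<le> sqrt (metric_in_chart M \<phi> a w w) \<and>
      sqrt (metric_in_chart M \<phi> a w w) \<le> C * norm w" if a: "a \<in> K" for a w
  proof (cases "w = 0")
    case True
    have "a \<in> snd \<phi> ` fst \<phi>" using a K(2) by blast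
    from bilinear_lzero[OF metric_in_chart_bilinear[OF M \<phi> this]] True show ?thesis by simp
  next
    case False
    have "a \<in> snd \<phi> ` fst \<phi>" using a K(2) by blast
    note bil = metric_in_chart_bilinear[OF M \<phi> this]
    define u where "u = w /\<^sub>R norm w"
    have w: "w = norm w *\<^sub>R u"
      using False by (simp add: u_def)
    have "metric_in_chart M \<phi> a w w = (norm w)\<^sup>2 * metric_in_chart M \<phi> a u u"
      by (subst (1 2) w) (simp add: bilinear_lmul[OF bil] bilinear_rmul[OF bil] power2_eq_square)
    then have "sqrt (metric_in_chart M \<phi> a w w) = norm w * sqrt (metric_in_chart M \<phi> a u u)"
      by (simp add: real_sqrt_mult)
    moreover have "m \<le> sqrt (metric_in_chart M \<phi> a u u) \<and> sqrt (metric_in_chart M \<phi> a u u) \<le> C"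
      using mC(3)[of "(a, u)"] a False by (simp add: u_def)
    ultimately show ?thesis
      by (simp add: mult.commute[of _ "norm w"] mult_left_mono)
  qed
  then show ?thesis
    using that mC(1,2) by blast
qed

section \<open>Speed and length of curves\<close>

definition speed :: "('a, 'e::real_normed_vector) riemannian \<Rightarrow> (real \<Rightarrow> 'a) \<Rightarrow> real \<Rightarrow> real" where
  "speed M \<gamma> t =
     (let v = vector_derivative (snd (chart_at M (\<gamma> t)) \<circ> \<gamma>) (at t)
      in sqrt (metric M (\<gamma> t) v v))"

lemma curve_length_speed: "curve_length M \<gamma> = (\<integral>\<^sup>+t\<in>{0..1}. ennreal (speed M \<gamma> t) \<partial>lborel)"
  unfolding curve_length_def speed_def Let_def ..

text \<open>The length of a curve measures its velocity at \<open>t\<close> in the preferred chart at \<open>\<gamma> t\<close>, which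
  may jump as \<open>t\<close> varies. By the chain rule the speed can be computed in one chart throughout.\<close>

lemma speed_in_chart:
  assumes M: "riemannian_manifold M" and \<phi>: "\<phi> \<in> atlas M" and t: "\<gamma> t \<in> fst \<phi>"
    and cont: "isCont \<gamma> t" and d: "((snd \<phi> \<circ> \<gamma>) has_vector_derivative v) (at t)"
  shows "speed M \<gamma> t = sqrt (metric_in_chart M \<phi> (snd \<phi> (\<gamma> t)) v v)"
proof -
  note D = riemannian_manifoldD[OF M]
  let ?\<psi> = "chart_at M (\<gamma> t)" and ?a = "snd \<phi> (\<gamma> t)"
  let ?T = "frechet_derivative (snd ?\<psi> \<circ> chart_inv \<phi>) (at ?a)"
  have "((snd ?\<psi> \<circ> chart_inv \<phi>) has_derivative ?T) (at ((snd \<phi> \<circ> \<gamma>) t))"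
    using transition_derivative(2)[OF D(1) \<phi> D(5), of ?a] t D(6) by auto
  then have chain:
    "((snd ?\<psi> \<circ> chart_inv \<phi>) \<circ> (snd \<phi> \<circ> \<gamma>) has_vector_derivative ?T v) (at t)"
    by (rule vector_derivative_diff_chain_within[OF d has_derivative_at_withinI])
  have "\<forall>\<^sub>F s in nhds t. \<gamma> s \<in> fst \<phi>"
    using cont t manifold_chartD(1)[OF D(1) \<phi>]
    by (simp add: isCont_def eventually_nhds_conv_at tendsto_def)
  then have "\<forall>\<^sub>F s in nhds t. s \<in> UNIV \<longrightarrow>
      ((snd ?\<psi> \<circ> chart_inv \<phi>) \<circ> (snd \<phi> \<circ> \<gamma>)) s = (snd ?\<psi> \<circ> \<gamma>) s"
    by eventually_elim (simp add: manifold_chartD(4)[OF D(1) \<phi>])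
  then have "((snd ?\<psi> \<circ> \<gamma>) has_vector_derivative ?T v) (at t)"
    by (rule has_vector_derivative_cong_ev[THEN iffD1, OF _ _ chain])
      (simp add: manifold_chartD(4)[OF D(1) \<phi> t])
  then have "vector_derivative (snd ?\<psi> \<circ> \<gamma>) (at t) = ?T v"
    by (rule vector_derivative_at)
  then show ?thesis
    by (simp add: speed_def metric_in_chart_def Let_def manifold_chartD(4)[OF D(1) \<phi> t])
qed

text \<open>What is used of piecewise \<open>C\<^sup>1\<close> curves: they are continuous, and differentiable away from a
  finite set of parameters, which no integral notices.\<close>

lemma piecewise_C1_curveE:
  assumes "piecewise_C1_curve M \<gamma>"
  obtains B where "finite B" "continuous_on {0..1} \<gamma>"
    "\<And>t \<phi>. t \<in> {0<..<1} - B \<Longrightarrow> \<phi> \<in> atlas M \<Longrightarrow> \<gamma> t \<in> fst \<phi> \<Longrightarrow>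
      (snd \<phi> \<circ> \<gamma>) differentiable (at t)"
proof -
  obtain n :: nat and s where s: "s 0 = 0" "s n = 1" "\<And>i. i < n \<Longrightarrow> s i < s (Suc i)"
      "\<And>i. i < n \<Longrightarrow> C1_curve_on M {s i..s (Suc i)} \<gamma>"
    using assms unfolding piecewise_C1_curve_def by blast
  have "0 \<le> s i \<and> continuous_on {0..s i} \<gamma> \<and>
      (\<forall>t\<in>{0..s i} - s ` {..n}. \<exists>j<n. t \<in> {s j<..<s (Suc j)})" if "i \<le> n" for i
    using that
  proof (induction i)
    case 0
    then show ?case using s(1) by auto
  next
    case (Suc i)
    then have i: "i < n" by simp
    have IH: "0 \<le> s i" "continuous_on {0..s i} \<gamma>"
      "\<And>t. t \<in> {0..s i} - s ` {..n} \<Longrightarrow> \<exists>j<n. t \<in> {s j<..<s (Suc j)}"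
      using Suc by auto
    have un: "{0..s (Suc i)} = {0..s i} \<union> {s i..s (Suc i)}"
      using IH(1) s(3)[OF i] by auto
    have "continuous_on {0..s (Suc i)} \<gamma>"
      unfolding un using IH(2) s(4)[OF i]
      by (intro continuous_on_closed_Un) (auto simp: C1_curve_on_def)
    moreover have "\<exists>j<n. t \<in> {s j<..<s (Suc j)}" if t: "t \<in> {0..s (Suc i)} - s ` {..n}" for t
    proof (cases "t \<le> s i")
      case True
      then show ?thesis using IH(3) t by auto
    next
      case False
      have "t \<noteq> s (Suc i)" using t i by auto
      then show ?thesis using False t i by (intro exI[of _ i]) auto
    qed
    ultimately show ?case
      using IH(1) s(3)[OF i] by auto
  qed
  from this[of n] have c: "continuous_on {0..1} \<gamma>"
    and j: "\<And>t. t \<in> {0..1} - s ` {..n} \<Longrightarrow> \<exists>j<n. t \<in> {s j<..<s (Suc j)}"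
    using s(2) by auto
  show ?thesis
  proof (rule that[of "s ` {..n}"])
    fix t \<phi>
    assume t: "t \<in> {0<..<1} - s ` {..n}" and \<phi>: "\<phi> \<in> atlas M" "\<gamma> t \<in> fst \<phi>"
    have "t \<in> {0..1} - s ` {..n}" using t by auto
    then obtain j where j: "j < n" "t \<in> {s j<..<s (Suc j)}"
      using j by blast
    obtain D where "\<forall>t \<in> {s j..s (Suc j)} \<inter> \<gamma> -` fst \<phi>.
        ((snd \<phi> \<circ> \<gamma>) has_vector_derivative D t) (at t within {s j..s (Suc j)})"
      using s(4)[OF j(1)] \<phi>(1) unfolding C1_curve_on_def by blast
    then have "((snd \<phi> \<circ> \<gamma>) has_vector_derivative D t) (at t within {s j..s (Suc j)})"
      using j(2) \<phi>(2) by auto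
    then have "((snd \<phi> \<circ> \<gamma>) has_vector_derivative D t) (at t)"
      using j(2) by (simp add: at_within_Icc_at)
    then show "(snd \<phi> \<circ> \<gamma>) differentiable (at t)"
      by (rule differentiableI_vector)
  qed (use c in auto)
qed

text \<open>The fundamental theorem of calculus yields a Henstock-Kurzweil integral, while lengths are
  integrals of nonnegative functions with values in \<open>[0, \<infinity>]\<close>. As \<open>ennreal\<close> sends negative numbers to
  \<open>0\<close>, the right-hand side is the Lebesgue integral of the positive part of \<open>h\<close>; either it is infinite,
  or the positive part is absolutely integrable and dominates \<open>h\<close>.\<close>

lemma has_integral_le_nn_integral:
  fixes h :: "real \<Rightarrow> real"
  assumes "(h has_integral r) S" "S \<in> sets lborel"
  shows "ennreal r \<le> (\<integral>\<^sup>+t\<in>S. ennreal (h t) \<partial>lborel)"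
proof (cases "(\<integral>\<^sup>+t\<in>S. ennreal (h t) \<partial>lborel) = \<infinity>")
  case False
  let ?g = "\<lambda>t. max 0 (h t) * indicator S t"
  have h: "h \<in> borel_measurable (lebesgue_on S)"
    using assms(1) by (intro integrable_imp_measurable) blast
  have "(\<lambda>t. if t \<in> S then h t else 0) \<in> borel_measurable lebesgue"
    using h assms(2) by (subst borel_measurable_if) auto
  then have "(\<lambda>t. max 0 (if t \<in> S then h t else 0)) \<in> borel_measurable lebesgue"
    by (intro borel_measurable_max) auto
  also have "(\<lambda>t. max 0 (if t \<in> S then h t else 0)) = ?g"
    by (auto simp: fun_eq_iff)
  finally have gm: "?g \<in> borel_measurable lebesgue" .
  have eq: "(\<integral>\<^sup>+t. ennreal (?g t) \<partial>lebesgue) = (\<integral>\<^sup>+t\<in>S. ennreal (h t) \<partial>lborel)"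
    unfolding nn_integral_completion
    by (intro nn_integral_cong) (auto simp: indicator_def ennreal_eq_0_iff max_def)
  have gi: "integrable lebesgue ?g"
    by (rule integrableI_nonneg[OF gm]) (use False eq in \<open>auto simp: top.not_eq_extremum\<close>)
  have "set_integrable lebesgue S (\<lambda>t. max 0 (h t))"
    using gi unfolding set_integrable_def by (simp add: mult.commute)
  then have "((\<lambda>t. max 0 (h t)) has_integral (LINT t:S|lebesgue. max 0 (h t))) S"
    by (rule has_integral_set_lebesgue)
  then have "r \<le> (LINT t:S|lebesgue. max 0 (h t))"
    by (rule has_integral_le[OF assms(1)]) auto
  also have "\<dots> = integral\<^sup>L lebesgue ?g"
    unfolding set_lebesgue_integral_def by (simp add: mult.commute)
  finally have "ennreal r \<le> ennreal (integral\<^sup>L lebesgue ?g)"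
    by (rule ennreal_leI)
  also have "\<dots> = (\<integral>\<^sup>+t. ennreal (?g t) \<partial>lebesgue)"
    by (rule nn_integral_eq_integral[OF gi, symmetric]) auto
  finally show ?thesis
    using eq by simp
qed auto

section \<open>Riemannian distance and topology\<close>

text \<open>The line segment from \<open>p\<close> to \<open>x\<close> in a chart is a curve whose length is at most a constant times
  the Euclidean distance of the coordinates.\<close>

lemma riemannian_dist_small_nearby:
  fixes M :: "('p::{t2_space, second_countable_topology}, 'e::{real_inner, heine_borel}) riemannian"
  assumes M: "riemannian_manifold M" and e: "0 < e"
  shows "\<forall>\<^sub>F x in nhds p. riemannian_dist M p x < ennreal e"
proof -
  note D = riemannian_manifoldD[OF M]
  define \<phi> where "\<phi> = chart_at M p"
  define a where "a = snd \<phi> p"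
  have \<phi>: "\<phi> \<in> atlas M" "p \<in> fst \<phi>"
    unfolding \<phi>_def by (rule D)+
  note c = manifold_chartD[OF D(1) \<phi>(1)]
  obtain r where r: "0 < r" "cball a r \<subseteq> snd \<phi> ` fst \<phi>"
    using c(2) \<phi>(2) unfolding a_def open_contains_cball by blast
  have "compact (cball a r)"
    by (simp add: compact_eq_bounded_closed)
  from metric_in_chart_equivalent_norm[OF M \<phi>(1) this r(2)] obtain C where C: "0 < C"
      "\<And>b w. b \<in> cball a r \<Longrightarrow> sqrt (metric_in_chart M \<phi> b w w) \<le> C * norm w"
    by metis
  have small: "riemannian_dist M p x < ennreal e"
    if x: "x \<in> fst \<phi>" "snd \<phi> x \<in> ball a (min r (e / C))" for x
  proof -
    define u where "u = snd \<phi> x - a"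
    define \<l> where "\<l> t = a + t *\<^sub>R u" for t :: real
    define \<gamma> where "\<gamma> = chart_inv \<phi> \<circ> \<l>"
    have u: "norm u < r" "C * norm u < e"
      using x(2) C(1) by (auto simp: u_def dist_norm norm_minus_commute field_simps)
    have \<l>: "\<l> t \<in> cball a r" if "t \<in> {0..1}" for t
    proof -
      have "norm (t *\<^sub>R u) \<le> 1 * norm u"
        using that by (simp add: mult_right_mono mult_left_le_one_le)
      then show ?thesis using u(1) by (simp add: \<l>_def dist_norm)
    qed
    have \<gamma>: "\<gamma> t \<in> fst \<phi>" "snd \<phi> (\<gamma> t) = \<l> t" if t: "t \<in> {0..1}" for t
    proof -
      obtain y where y: "y \<in> fst \<phi>" "\<l> t = snd \<phi> y"
        using \<l>[OF t] r(2) by blast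
      then show "\<gamma> t \<in> fst \<phi>" "snd \<phi> (\<gamma> t) = \<l> t"
        using c(4) by (simp_all add: \<gamma>_def)
    qed
    have \<l>': "(\<l> has_vector_derivative u) F" for F
      unfolding \<l>_def has_vector_derivative_def by (auto intro!: derivative_eq_intros)
    have \<l>cont: "continuous_on A \<l>" for A
      unfolding \<l>_def by (intro continuous_intros)
    have cont: "continuous_on {0..1} \<gamma>"
      unfolding \<gamma>_def
    proof (rule continuous_on_compose[OF \<l>cont])
      show "continuous_on (\<l> ` {0..1}) (chart_inv \<phi>)"
      proof (rule continuous_on_subset)
        show "continuous_on (snd \<phi> ` fst \<phi>) (chart_inv \<phi>)"
          using c(3) by (simp add: homeomorphism_def)
        show "\<l> ` {0..1} \<subseteq> snd \<phi> ` fst \<phi>"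
          using \<l> r(2) by blast
      qed
    qed
    have C1: "C1_curve_on M {0..1} \<gamma>"
      unfolding C1_curve_on_def
    proof (intro conjI cont ballI)
      fix \<psi> assume \<psi>: "\<psi> \<in> atlas M"
      let ?T = "\<lambda>b. frechet_derivative (snd \<psi> \<circ> chart_inv \<phi>) (at b)"
      let ?A = "{0..1} \<inter> \<gamma> -` fst \<psi>"
      have in_overlap: "\<l> t \<in> snd \<phi> ` (fst \<phi> \<inter> fst \<psi>)" if "t \<in> ?A" for t
        using that \<gamma>[of t] by (auto intro!: image_eqI[of _ _ "\<gamma> t"])
      have "continuous_on ?A (\<lambda>t. ?T (\<l> t) u)"
        by (rule continuous_on_compose2[OF transition_derivative(3)[OF D(1) \<phi>(1) \<psi>] \<l>cont])
          (use in_overlap in blast)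
      moreover have "((snd \<psi> \<circ> \<gamma>) has_vector_derivative ?T (\<l> t) u) (at t within {0..1})"
        if "t \<in> ?A" for t
        unfolding \<gamma>_def comp_assoc[symmetric]
        by (rule vector_derivative_diff_chain_within[OF \<l>' has_derivative_at_withinI])
          (rule transition_derivative(2)[OF D(1) \<phi>(1) \<psi> in_overlap[OF that]])
      ultimately show "\<exists>D. continuous_on ?A D \<and>
          (\<forall>t\<in>?A. ((snd \<psi> \<circ> \<gamma>) has_vector_derivative D t) (at t within {0..1}))"
        by blast
    qed
    then have pw: "piecewise_C1_curve M \<gamma>"
      unfolding piecewise_C1_curve_def by (intro exI[of _ 1] exI[of _ real]) simp
    have ends: "\<gamma> 0 = p" "\<gamma> 1 = x"
      using c(4) \<phi>(2) x(1) by (simp_all add: \<gamma>_def \<l>_def u_def a_def)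
    have speed: "speed M \<gamma> t \<le> C * norm u" if t: "t \<in> {0<..<1}" for t
    proof -
      have t': "t \<in> {0..1}" using t by simp
      have "isCont \<gamma> t"
        by (rule continuous_on_interior[OF cont]) (use t in simp)
      moreover have "((snd \<phi> \<circ> \<gamma>) has_vector_derivative u) (at t)"
        by (rule has_vector_derivative_transform_within_open[OF \<l>' _ t]) (use \<gamma>(2) in auto)
      ultimately show ?thesis
        using speed_in_chart[of M \<phi> \<gamma> t u, OF M \<phi>(1) \<gamma>(1)[OF t']] C(2)[OF \<l>[OF t'], of u]
          \<gamma>(2)[OF t'] by simp
    qed
    have "AE t in lborel. t \<notin> {0, 1::real}"
      by (intro AE_not_in finite_imp_null_set_lborel) simp
    then have "AE t in lborel. ennreal (speed M \<gamma> t) * indicator {0..1} t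
        \<le> ennreal (C * norm u) * indicator {0..1} t"
    proof eventually_elim
      case (elim t)
      then show ?case
        using speed[of t] by (cases "t \<in> {0..1}") (auto intro!: ennreal_leI)
    qed
    then have "curve_length M \<gamma> \<le> (\<integral>\<^sup>+t\<in>{0..1::real}. ennreal (C * norm u) \<partial>lborel)"
      unfolding curve_length_speed by (rule nn_integral_mono_AE)
    also have "\<dots> = ennreal (C * norm u)"
      by (simp add: nn_integral_cmult_indicator)
    also have "\<dots> < ennreal e"
      using u(2) e C(1) by (simp add: ennreal_less_iff)
    finally have "curve_length M \<gamma> < ennreal e" .
    then show ?thesis
      unfolding riemannian_dist_def using pw ends by (auto simp: INF_less_iff)
  qed
  have "open (fst \<phi> \<inter> snd \<phi> -` ball a (min r (e / C)))"
    using c(1,3) by (intro continuous_open_preimage) (auto simp: homeomorphism_def)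
  moreover have "p \<in> fst \<phi> \<inter> snd \<phi> -` ball a (min r (e / C))"
    using \<phi>(2) r(1) e C(1) by (simp add: a_def)
  ultimately show ?thesis
    using small unfolding eventually_nhds by blast
qed

text \<open>A curve from \<open>p\<close> that leaves \<open>U\<close> first has to reach the boundary of a coordinate ball of some
  radius \<open>r\<close> around \<open>p\<close> inside \<open>U\<close>. Up to that time it travels at least the Euclidean distance \<open>r\<close>
  in coordinates, so its length is at least \<open>m * r\<close>, with \<open>m\<close> the lower bound for the metric
  on the ball.\<close>

lemma riemannian_dist_bounded_below_outside:
  fixes M :: "('p::{t2_space, second_countable_topology}, 'e::{real_inner, heine_borel}) riemannian"
  assumes M: "riemannian_manifold M" and U: "open U" "p \<in> U"
  obtains \<epsilon> where "0 < \<epsilon>" "\<And>q. q \<notin> U \<Longrightarrow> ennreal \<epsilon> \<le> riemannian_dist M p q"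
proof -
  note D = riemannian_manifoldD[OF M]
  define \<phi> where "\<phi> = chart_at M p"
  define a where "a = snd \<phi> p"
  have \<phi>: "\<phi> \<in> atlas M" "p \<in> fst \<phi>"
    unfolding \<phi>_def by (rule D)+
  note c = manifold_chartD[OF D(1) \<phi>(1)]
  have \<phi>cont: "continuous_on (fst \<phi>) (snd \<phi>)"
    "continuous_on (snd \<phi> ` fst \<phi>) (chart_inv \<phi>)"
    using c(3) by (auto simp: homeomorphism_def)
  have "a \<in> snd \<phi> ` (fst \<phi> \<inter> U)"
    using \<phi>(2) U(2) by (simp add: a_def)
  then obtain r where r: "0 < r" "cball a r \<subseteq> snd \<phi> ` (fst \<phi> \<inter> U)"
    using chart_image_open[OF D(1) \<phi>(1) U(1)] unfolding open_contains_cball by blast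
  have r': "cball a r \<subseteq> snd \<phi> ` fst \<phi>" using r(2) by blast
  have K: "compact (cball a r)"
    by (simp add: compact_eq_bounded_closed)
  from metric_in_chart_equivalent_norm[OF M \<phi>(1) K r'] obtain m where m: "0 < m"
      "\<And>b w. b \<in> cball a r \<Longrightarrow> m * norm w \<le> sqrt (metric_in_chart M \<phi> b w w)"
    by metis
  have long: "ennreal (m * r) \<le> curve_length M \<gamma>"
    if \<gamma>: "piecewise_C1_curve M \<gamma>" "\<gamma> 0 = p" "\<gamma> 1 \<notin> U" for \<gamma>
  proof -
    obtain B where B: "finite B" "continuous_on {0..1} \<gamma>"
      "\<And>t. t \<in> {0<..<1} - B \<Longrightarrow> \<gamma> t \<in> fst \<phi> \<Longrightarrow> (snd \<phi> \<circ> \<gamma>) differentiable (at t)"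
      using piecewise_C1_curveE[OF \<gamma>(1)] \<phi>(1) by metis
    define V where "V = fst \<phi> \<inter> snd \<phi> -` ball a r"
    have "open V"
      unfolding V_def by (rule continuous_open_preimage[OF \<phi>cont(1) c(1)]) simp
    have VU: "x \<in> U" if "x \<in> V" for x
    proof -
      have "snd \<phi> x \<in> snd \<phi> ` (fst \<phi> \<inter> U)"
        using that r(2) by (auto simp: V_def)
      then obtain y where "y \<in> fst \<phi>" "y \<in> U" "snd \<phi> x = snd \<phi> y" by blast
      then have "x = y"
        using c(4) that unfolding V_def by (metis IntD1)
      then show ?thesis using \<open>y \<in> U\<close> by simp
    qed
    \<comment> \<open>The minimum \<open>\<tau>\<close> of the closed set \<open>E\<close> is the time of the first exit from the open ball \<open>V\<close>.\<close>
    define E where "E = {0..1} \<inter> \<gamma> -` (- V)"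
    have "closed E"
      unfolding E_def using \<open>open V\<close> by (intro continuous_closed_preimage B(2)) auto
    moreover have "bounded E"
      by (rule bounded_subset[of "{0..1}"]) (auto simp: E_def)
    ultimately have "compact E"
      by (simp add: compact_eq_bounded_closed)
    moreover have "1 \<in> E"
      using \<gamma>(3) VU by (auto simp: E_def)
    ultimately obtain \<tau> where \<tau>: "\<tau> \<in> E" "\<And>t. t \<in> E \<Longrightarrow> \<tau> \<le> t"
      using compact_attains_inf[of E] by blast
    have "0 \<notin> E"
      using \<gamma>(2) \<phi>(2) r(1) by (simp add: E_def V_def a_def)
    then have \<tau>01: "0 < \<tau>" "\<tau> \<le> 1"
      using \<tau>(1) by (auto simp: E_def intro: le_neq_trans)
    have inV: "\<gamma> t \<in> V" if "t \<in> {0..<\<tau>}" for t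
      using that \<tau>01 \<tau>(2)[of t] by (auto simp: E_def)
    \<comment> \<open>The closed ball is compact, hence closed in the (Hausdorff) manifold, so \<open>\<gamma> \<tau>\<close> still lies in
      the chart domain, on the boundary of the ball.\<close>
    have "compact (chart_inv \<phi> ` cball a r)"
      by (rule compact_continuous_image[OF continuous_on_subset[OF \<phi>cont(2) r'] K])
    then have "closed ({0..1} \<inter> \<gamma> -` (chart_inv \<phi> ` cball a r))"
      by (intro continuous_closed_preimage B(2) compact_imp_closed) auto
    moreover have "{0..<\<tau>} \<subseteq> {0..1} \<inter> \<gamma> -` (chart_inv \<phi> ` cball a r)"
    proof
      fix t assume t: "t \<in> {0..<\<tau>}"
      have "\<gamma> t = chart_inv \<phi> (snd \<phi> (\<gamma> t))" "snd \<phi> (\<gamma> t) \<in> cball a r"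
        using inV[OF t] c(4) by (auto simp: V_def)
      then show "t \<in> {0..1} \<inter> \<gamma> -` (chart_inv \<phi> ` cball a r)"
        using t \<tau>01 by (auto intro: image_eqI)
    qed
    ultimately have "closure {0..<\<tau>} \<subseteq> {0..1} \<inter> \<gamma> -` (chart_inv \<phi> ` cball a r)"
      by (rule closure_minimal[rotated])
    moreover have "\<tau> \<in> closure {0..<\<tau>}"
      using \<tau>01 by simp
    ultimately have "\<tau> \<in> {0..1} \<inter> \<gamma> -` (chart_inv \<phi> ` cball a r)"
      by (rule subsetD)
    then obtain b where b: "b \<in> cball a r" "\<gamma> \<tau> = chart_inv \<phi> b"
      by blast
    then have \<gamma>\<tau>: "\<gamma> \<tau> \<in> fst \<phi>" "snd \<phi> (\<gamma> \<tau>) = b"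
      using r' c(4) by fastforce+
    have nb: "norm (b - a) = r"
      using \<tau>(1) b(1) \<gamma>\<tau> by (auto simp: E_def V_def dist_norm norm_minus_commute)
    have dom: "\<gamma> t \<in> fst \<phi>" "snd \<phi> (\<gamma> t) \<in> cball a r" if "t \<in> {0..\<tau>}" for t
      using that inV[of t] \<gamma>\<tau> b(1) by (cases "t = \<tau>"; auto simp: V_def)+
    \<comment> \<open>Projecting to the direction \<open>e\<close> of the exit point makes the motion real-valued; the component
      of the velocity along \<open>e\<close> bounds its norm from below and integrates to \<open>r\<close>.\<close>
    define e where "e = (b - a) /\<^sub>R r"
    have e: "norm e = 1" "(b - a) \<bullet> e = r"
      using nb r(1) by (simp_all add: e_def dot_square_norm power2_eq_square)
    define f where "f t = m * ((snd \<phi> \<circ> \<gamma>) t \<bullet> e)" for t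
    define f' where "f' t = m * (vector_derivative (snd \<phi> \<circ> \<gamma>) (at t) \<bullet> e)" for t
    have diff: "((snd \<phi> \<circ> \<gamma>) has_vector_derivative vector_derivative (snd \<phi> \<circ> \<gamma>) (at t)) (at t)"
      if "t \<in> {0<..<\<tau>} - B" for t
      using B(3)[of t] dom(1)[of t] that \<tau>01 by (simp add: vector_derivative_works)
    have "(f' has_integral (f \<tau> - f 0)) {0..\<tau>}"
    proof (rule fundamental_theorem_of_calculus_interior_strong[OF B(1)])
      show "(f has_vector_derivative f' t) (at t)" if "t \<in> {0<..<\<tau>} - B" for t
      proof -
        have "bounded_linear (\<lambda>w. m * (w \<bullet> e))"
          by (intro bounded_linear_mult_right[THEN bounded_linear_compose] bounded_linear_inner_left)
        from bounded_linear.has_vector_derivative[OF this diff[OF that]] show ?thesis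
          unfolding f_def f'_def .
      qed
      have "continuous_on {0..\<tau>} (snd \<phi> \<circ> \<gamma>)"
      proof (rule continuous_on_compose)
        show "continuous_on {0..\<tau>} \<gamma>"
          by (rule continuous_on_subset[OF B(2)]) (use \<tau>01 in auto)
        show "continuous_on (\<gamma> ` {0..\<tau>}) (snd \<phi>)"
          by (rule continuous_on_subset[OF \<phi>cont(1)]) (use dom(1) in blast)
      qed
      then show "continuous_on {0..\<tau>} f"
        unfolding f_def by (intro continuous_on_mult continuous_on_const continuous_on_inner)
    qed (use \<tau>01 in simp)
    moreover have "f \<tau> - f 0 = m * r"
      using e(2) \<gamma>(2) \<gamma>\<tau>(2)
      by (simp add: f_def a_def right_diff_distrib[symmetric] inner_diff_left[symmetric])
    ultimately have "ennreal (m * r) \<le> (\<integral>\<^sup>+t\<in>{0..\<tau>}. ennreal (f' t) \<partial>lborel)"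
      using has_integral_le_nn_integral[of f' "m * r" "{0..\<tau>}"] by simp
    also have "\<dots> \<le> curve_length M \<gamma>"
      unfolding curve_length_speed
    proof (rule nn_integral_mono_AE)
      have le: "f' t \<le> speed M \<gamma> t" if t: "t \<in> {0<..<\<tau>} - B" for t
      proof -
        let ?v = "vector_derivative (snd \<phi> \<circ> \<gamma>) (at t)"
        have t': "t \<in> {0..\<tau>}" using t by simp
        have "?v \<bullet> e \<le> norm ?v"
          using norm_cauchy_schwarz[of ?v e] e(1) by simp
        then have "f' t \<le> m * norm ?v"
          using m(1) by (simp add: f'_def)
        also have "\<dots> \<le> sqrt (metric_in_chart M \<phi> (snd \<phi> (\<gamma> t)) ?v ?v)"
          by (rule m(2)[OF dom(2)[OF t']])
        also have "\<dots> = speed M \<gamma> t"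
        proof (rule speed_in_chart[symmetric, OF M \<phi>(1) dom(1)[OF t'] _ diff[OF t]])
          show "isCont \<gamma> t"
            by (rule continuous_on_interior[OF B(2)]) (use t \<tau>01 in simp)
        qed
        finally show ?thesis .
      qed
      have "AE t in lborel. t \<notin> B \<union> {0, \<tau>}"
        using B(1) by (intro AE_not_in finite_imp_null_set_lborel) simp
      then show "AE t in lborel. ennreal (f' t) * indicator {0..\<tau>} t
          \<le> ennreal (speed M \<gamma> t) * indicator {0..1} t"
      proof eventually_elim
        case (elim t)
        then show ?case
          using le[of t] \<tau>01 by (cases "t \<in> {0..\<tau>}") (auto intro!: ennreal_leI)
      qed
    qed
    finally show ?thesis .
  qed
  show ?thesis
  proof (rule that[of "m * r"])
    show "0 < m * r" using m(1) r(1) by simp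
    show "ennreal (m * r) \<le> riemannian_dist M p q" if "q \<notin> U" for q
      unfolding riemannian_dist_def using long that by (intro INF_greatest) auto
  qed
qed

section \<open>Projections of product manifolds\<close>

text \<open>The map \<open>\<pi>\<close> looks like the map \<open>L\<close> in the charts \<open>\<eta>\<close> and \<open>\<phi>\<close>. This form covers both
  factor projections of a product at once, with \<open>L\<close> the corresponding projection of the model space.\<close>

definition linear_lift ::
  "('p \<Rightarrow> 'q) \<Rightarrow> ('e \<Rightarrow> 'f) \<Rightarrow> ('p::topological_space, 'e) chart \<Rightarrow> ('q, 'f) chart \<Rightarrow> bool"
where
  "linear_lift \<pi> L \<eta> \<phi> \<longleftrightarrow>
     open (fst \<eta>) \<and> (\<forall>y\<in>fst \<eta>. \<pi> y \<in> fst \<phi> \<and> snd \<phi> (\<pi> y) = L (snd \<eta> y))"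

text \<open>For each chart \<open>\<phi>\<close> of \<open>M\<close> a single continuous derivative is required on the whole preimage of
  its domain, while a chart \<open>\<eta>\<close> of \<open>P\<close> may cover only part of this preimage. The local derivatives
  \<open>L \<circ> D\<close> agree by uniqueness of derivatives on a nondegenerate interval, so they glue.\<close>

lemma C1_curve_on_project:
  fixes L :: "'e::real_normed_vector \<Rightarrow> 'f::real_normed_vector"
  assumes \<gamma>: "C1_curve_on P {a..b} \<gamma>" and ab: "a < b"
    and \<pi>: "continuous_on UNIV \<pi>" and L: "bounded_linear L"
    and lift: "\<And>\<phi> x. \<phi> \<in> atlas M \<Longrightarrow> \<pi> x \<in> fst \<phi> \<Longrightarrow>
      \<exists>\<eta>\<in>atlas P. x \<in> fst \<eta> \<and> linear_lift \<pi> L \<eta> \<phi>"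
  shows "C1_curve_on M {a..b} (\<pi> \<circ> \<gamma>)"
  unfolding C1_curve_on_def
proof (intro conjI ballI)
  have cont: "continuous_on {a..b} \<gamma>"
    using \<gamma> unfolding C1_curve_on_def by blast
  show "continuous_on {a..b} (\<pi> \<circ> \<gamma>)"
    by (intro continuous_on_compose cont continuous_on_subset[OF \<pi>]) simp
  fix \<phi> assume \<phi>: "\<phi> \<in> atlas M"
  let ?A = "{a..b} \<inter> (\<pi> \<circ> \<gamma>) -` fst \<phi>"
  let ?D = "\<lambda>t. vector_derivative (snd \<phi> \<circ> (\<pi> \<circ> \<gamma>)) (at t within {a..b})"
  have local: "\<exists>G D. open G \<and> t \<in> G \<and> continuous_on (?A \<inter> G) D \<and>
      (\<forall>s\<in>?A \<inter> G. ((snd \<phi> \<circ> (\<pi> \<circ> \<gamma>)) has_vector_derivative D s) (at s within {a..b}))"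
    if t: "t \<in> ?A" for t
  proof -
    obtain \<eta> where \<eta>: "\<eta> \<in> atlas P" "\<gamma> t \<in> fst \<eta>" "linear_lift \<pi> L \<eta> \<phi>"
      using lift[OF \<phi>, of "\<gamma> t"] t unfolding vimage_def comp_apply by blast
    obtain D where D: "continuous_on ({a..b} \<inter> \<gamma> -` fst \<eta>) D"
      "\<And>s. s \<in> {a..b} \<inter> \<gamma> -` fst \<eta> \<Longrightarrow>
        ((snd \<eta> \<circ> \<gamma>) has_vector_derivative D s) (at s within {a..b})"
      using \<gamma> \<eta>(1) unfolding C1_curve_on_def by blast
    obtain G where G: "open G" "G \<inter> {a..b} = \<gamma> -` fst \<eta> \<inter> {a..b}"
      using cont \<eta>(3) unfolding continuous_on_open_invariant linear_lift_def by blast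
    have AO: "?A \<inter> G = {a..b} \<inter> \<gamma> -` fst \<eta>"
    proof -
      have "\<gamma> -` fst \<eta> \<subseteq> (\<pi> \<circ> \<gamma>) -` fst \<phi>"
        using \<eta>(3) by (auto simp: linear_lift_def)
      then show ?thesis using G(2) by blast
    qed
    have "t \<in> G"
      using G(2) t \<eta>(2) by blast
    moreover have "continuous_on (?A \<inter> G) (\<lambda>s. L (D s))"
      unfolding AO by (rule bounded_linear.continuous_on[OF L D(1)])
    moreover have "((snd \<phi> \<circ> (\<pi> \<circ> \<gamma>)) has_vector_derivative L (D s)) (at s within {a..b})"
      if s: "s \<in> ?A \<inter> G" for s
    proof -
      have s': "s \<in> {a..b} \<inter> \<gamma> -` fst \<eta>" using s AO by simp
      have "((\<lambda>s. L ((snd \<eta> \<circ> \<gamma>) s)) has_vector_derivative L (D s)) (at s within {a..b})"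
        by (rule bounded_linear.has_vector_derivative[OF L D(2)[OF s']])
      moreover have "L ((snd \<eta> \<circ> \<gamma>) u) = (snd \<phi> \<circ> (\<pi> \<circ> \<gamma>)) u"
        if "u \<in> G" "u \<in> {a..b}" for u
      proof -
        have "\<gamma> u \<in> fst \<eta>" using G(2) that by blast
        then show ?thesis using \<eta>(3) by (simp add: linear_lift_def)
      qed
      then have "\<forall>\<^sub>F u in nhds s. u \<in> {a..b} \<longrightarrow>
          L ((snd \<eta> \<circ> \<gamma>) u) = (snd \<phi> \<circ> (\<pi> \<circ> \<gamma>)) u"
        unfolding eventually_nhds using s G(1) by (intro exI[of _ G]) simp
      moreover have "L ((snd \<eta> \<circ> \<gamma>) s) = (snd \<phi> \<circ> (\<pi> \<circ> \<gamma>)) s"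
        using s' \<eta>(3) by (auto simp: linear_lift_def)
      ultimately show ?thesis
        by (simp only: has_vector_derivative_cong_ev)
    qed
    ultimately show ?thesis using G(1) by blast
  qed
  have D_eq: "?D s = D' " if "s \<in> {a..b}"
    "((snd \<phi> \<circ> (\<pi> \<circ> \<gamma>)) has_vector_derivative D') (at s within {a..b})" for s D'
    using vector_derivative_within_cbox[OF ab, of s] that by simp
  show "\<exists>D. continuous_on ?A D \<and>
      (\<forall>t\<in>?A. ((snd \<phi> \<circ> (\<pi> \<circ> \<gamma>)) has_vector_derivative D t) (at t within {a..b}))"
  proof (intro exI conjI ballI)
    show "continuous_on ?A ?D"
      unfolding continuous_on_eq_continuous_within
    proof
      fix t assume t: "t \<in> ?A"
      obtain G D where OD: "open G" "t \<in> G" "continuous_on (?A \<inter> G) D"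
        "\<And>s. s \<in> ?A \<inter> G \<Longrightarrow>
          ((snd \<phi> \<circ> (\<pi> \<circ> \<gamma>)) has_vector_derivative D s) (at s within {a..b})"
        using local[OF t] by blast
      have "?D s = D s" if "s \<in> ?A \<inter> G" for s
        using D_eq OD(4)[OF that] that by blast
      then have "continuous_on (?A \<inter> G) ?D"
        by (intro continuous_on_eq[OF OD(3)]) simp
      then have "continuous (at t within (?A \<inter> G)) ?D"
        using t OD(2) by (simp add: continuous_on_eq_continuous_within)
      moreover have "at t within (?A \<inter> G) = at t within ?A"
        by (rule at_within_nhd[OF OD(2,1)]) blast
      ultimately show "continuous (at t within ?A) ?D"
        by simp
    qed
    fix t assume t: "t \<in> ?A"
    then obtain D' where "((snd \<phi> \<circ> (\<pi> \<circ> \<gamma>)) has_vector_derivative D') (at t within {a..b})"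
      using local[OF t] by blast
    then show "((snd \<phi> \<circ> (\<pi> \<circ> \<gamma>)) has_vector_derivative ?D t) (at t within {a..b})"
      using D_eq t by simp
  qed
qed

text \<open>The image of every curve is a curve, and as \<open>L\<close> does not increase the length of tangent vectors,
  the image is not longer.\<close>

lemma riemannian_dist_project_le:
  fixes L :: "'e::real_normed_vector \<Rightarrow> 'f::real_normed_vector"
  assumes \<pi>: "continuous_on UNIV \<pi>" and L: "bounded_linear L"
    and lift: "\<And>\<phi> x. \<phi> \<in> atlas M \<Longrightarrow> \<pi> x \<in> fst \<phi> \<Longrightarrow>
      \<exists>\<eta>\<in>atlas P. x \<in> fst \<eta> \<and> linear_lift \<pi> L \<eta> \<phi>"
    and chart_at: "\<And>x. chart_at P x \<in> atlas P" "\<And>x. x \<in> fst (chart_at P x)"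
      "\<And>x. linear_lift \<pi> L (chart_at P x) (chart_at M (\<pi> x))"
    and metric: "\<And>x v. metric M (\<pi> x) (L v) (L v) \<le> metric P x v v"
  shows "riemannian_dist M (\<pi> p) (\<pi> q) \<le> riemannian_dist P p q"
  unfolding riemannian_dist_def
proof (rule INF_mono)
  fix \<gamma> assume "\<gamma> \<in> {\<gamma>. piecewise_C1_curve P \<gamma> \<and> \<gamma> 0 = p \<and> \<gamma> 1 = q}"
  then have \<gamma>: "piecewise_C1_curve P \<gamma>" "\<gamma> 0 = p" "\<gamma> 1 = q" by auto
  have "piecewise_C1_curve M (\<pi> \<circ> \<gamma>)"
    using \<gamma>(1) C1_curve_on_project[OF _ _ \<pi> L lift] unfolding piecewise_C1_curve_def by meson
  moreover have "curve_length M (\<pi> \<circ> \<gamma>) \<le> curve_length P \<gamma>"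
    unfolding curve_length_speed
  proof (rule nn_integral_mono_AE)
    obtain B where B: "finite B" "continuous_on {0..1} \<gamma>"
      "\<And>t \<eta>. t \<in> {0<..<1} - B \<Longrightarrow> \<eta> \<in> atlas P \<Longrightarrow> \<gamma> t \<in> fst \<eta> \<Longrightarrow>
        (snd \<eta> \<circ> \<gamma>) differentiable (at t)"
      using piecewise_C1_curveE[OF \<gamma>(1)] by metis
    have le: "speed M (\<pi> \<circ> \<gamma>) t \<le> speed P \<gamma> t" if t: "t \<in> {0<..<1} - B" for t
    proof -
      let ?\<eta> = "chart_at P (\<gamma> t)" and ?\<phi> = "chart_at M (\<pi> (\<gamma> t))"
      define v where "v = vector_derivative (snd ?\<eta> \<circ> \<gamma>) (at t)"
      have lift_t: "open (fst ?\<eta>)" "\<And>y. y \<in> fst ?\<eta> \<Longrightarrow> snd ?\<phi> (\<pi> y) = L (snd ?\<eta> y)"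
        using chart_at(3)[of "\<gamma> t"] by (auto simp: linear_lift_def)
      have "((snd ?\<eta> \<circ> \<gamma>) has_vector_derivative v) (at t)"
        unfolding v_def using B(3)[OF t chart_at(1,2)] by (simp add: vector_derivative_works)
      then have chain: "((\<lambda>s. L ((snd ?\<eta> \<circ> \<gamma>) s)) has_vector_derivative L v) (at t)"
        by (rule bounded_linear.has_vector_derivative[OF L])
      have "isCont \<gamma> t"
        by (rule continuous_on_interior[OF B(2)]) (use t in simp)
      then have "\<forall>\<^sub>F s in nhds t. \<gamma> s \<in> fst ?\<eta>"
        using lift_t(1) chart_at(2)[of "\<gamma> t"]
        by (simp add: isCont_def eventually_nhds_conv_at tendsto_def)
      then have "\<forall>\<^sub>F s in nhds t. s \<in> UNIV \<longrightarrow>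
          L ((snd ?\<eta> \<circ> \<gamma>) s) = (snd ?\<phi> \<circ> (\<pi> \<circ> \<gamma>)) s"
        by eventually_elim (simp add: lift_t(2))
      then have "((snd ?\<phi> \<circ> (\<pi> \<circ> \<gamma>)) has_vector_derivative L v) (at t)"
        by (rule has_vector_derivative_cong_ev[THEN iffD1, OF _ _ chain])
          (simp add: lift_t(2) chart_at(2))
      then have "vector_derivative (snd ?\<phi> \<circ> (\<pi> \<circ> \<gamma>)) (at t) = L v"
        by (rule vector_derivative_at)
      then show ?thesis
        using metric[of "\<gamma> t" v] by (simp add: speed_def Let_def v_def)
    qed
    have "AE t in lborel. t \<notin> B \<union> {0, 1}"
      using B(1) by (intro AE_not_in finite_imp_null_set_lborel) simp
    then show "AE t in lborel. ennreal (speed M (\<pi> \<circ> \<gamma>) t) * indicator {0..1} t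
        \<le> ennreal (speed P \<gamma> t) * indicator {0..1} t"
    proof eventually_elim
      case (elim t)
      then show ?case
        using le[of t] by (cases "t \<in> {0..1}") (auto intro!: ennreal_leI)
    qed
  qed
  ultimately show "\<exists>\<delta>\<in>{\<delta>. piecewise_C1_curve M \<delta> \<and> \<delta> 0 = \<pi> p \<and> \<delta> 1 = \<pi> q}.
      curve_length M \<delta> \<le> curve_length P \<gamma>"
    using \<gamma>(2,3) by (intro bexI[of _ "\<pi> \<circ> \<gamma>"]) auto
qed

lemma prod_riemannian_chart:
  assumes "riemannian_manifold Y" "riemannian_manifold Z"
  shows "chart_at (prod_riemannian Y Z) x \<in> atlas (prod_riemannian Y Z)"
    and "x \<in> fst (chart_at (prod_riemannian Y Z) x)"
    and "\<phi> \<in> atlas Y \<Longrightarrow> \<psi> \<in> atlas Z \<Longrightarrow> prod_chart \<phi> \<psi> \<in> atlas (prod_riemannian Y Z)"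
    and "\<phi> \<in> atlas Y \<Longrightarrow> \<psi> \<in> atlas Z \<Longrightarrow> linear_lift fst fst (prod_chart \<phi> \<psi>) \<phi>"
    and "\<phi> \<in> atlas Y \<Longrightarrow> \<psi> \<in> atlas Z \<Longrightarrow> linear_lift snd snd (prod_chart \<phi> \<psi>) \<psi>"
    and "chart_at (prod_riemannian Y Z) x = prod_chart (chart_at Y (fst x)) (chart_at Z (snd x))"
proof -
  note DY = riemannian_manifoldD[OF assms(1)] and DZ = riemannian_manifoldD[OF assms(2)]
  show eq: "chart_at (prod_riemannian Y Z) x = prod_chart (chart_at Y (fst x)) (chart_at Z (snd x))"
    by (simp add: prod_riemannian_def prod_manifold_def case_prod_beta)
  show mem: "\<phi> \<in> atlas Y \<Longrightarrow> \<psi> \<in> atlas Z \<Longrightarrow> prod_chart \<phi> \<psi> \<in> atlas (prod_riemannian Y Z)"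
    for \<phi> \<psi>
    unfolding prod_riemannian_def prod_manifold_def riemannian.simps manifold.simps by blast
  show "chart_at (prod_riemannian Y Z) x \<in> atlas (prod_riemannian Y Z)"
    unfolding eq by (intro mem DY DZ)
  show "x \<in> fst (chart_at (prod_riemannian Y Z) x)"
    unfolding eq using DY(6) DZ(6) by (simp add: prod_chart_def mem_Times_iff)
  show "linear_lift fst fst (prod_chart \<phi> \<psi>) \<phi>" "linear_lift snd snd (prod_chart \<phi> \<psi>) \<psi>"
    if "\<phi> \<in> atlas Y" "\<psi> \<in> atlas Z"
    using manifold_chartD(1)[OF DY(1) that(1)] manifold_chartD(1)[OF DZ(1) that(2)]
    by (auto simp: linear_lift_def prod_chart_def open_Times)
qed

lemma riemannian_dist_le_prod:
  assumes Y: "riemannian_manifold Y" and Z: "riemannian_manifold Z"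
  shows riemannian_dist_fst_le:
      "riemannian_dist Y (fst p) (fst q) \<le> riemannian_dist (prod_riemannian Y Z) p q"
    and riemannian_dist_snd_le:
      "riemannian_dist Z (snd p) (snd q) \<le> riemannian_dist (prod_riemannian Y Z) p q"
proof -
  note DY = riemannian_manifoldD[OF Y] and DZ = riemannian_manifoldD[OF Z]
  note P = prod_riemannian_chart[OF Y Z]
  have metric: "metric (prod_riemannian Y Z) x v v =
      metric Y (fst x) (fst v) (fst v) + metric Z (snd x) (snd v) (snd v)" for x v
    by (simp add: prod_riemannian_def case_prod_beta)
  show "riemannian_dist Y (fst p) (fst q) \<le> riemannian_dist (prod_riemannian Y Z) p q"
  proof (rule riemannian_dist_project_le[OF _ bounded_linear_fst])
    fix \<phi> and x :: "'a \<times> 'c"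
    assume \<phi>: "\<phi> \<in> atlas Y" "fst x \<in> fst \<phi>"
    then show "\<exists>\<eta>\<in>atlas (prod_riemannian Y Z). x \<in> fst \<eta> \<and> linear_lift fst fst \<eta> \<phi>"
      using DZ(6)[of "snd x"]
      by (intro bexI[of _ "prod_chart \<phi> (chart_at Z (snd x))"])
        (auto simp: P DZ(5) prod_chart_def mem_Times_iff intro: P[unfolded prod_chart_def])
  next
    show "linear_lift fst fst (chart_at (prod_riemannian Y Z) x) (chart_at Y (fst x))" for x
      unfolding P(6) by (intro P(4) DY DZ)
    show "metric Y (fst x) (fst v) (fst v) \<le> metric (prod_riemannian Y Z) x v v" for x v
      unfolding metric using DZ(4) by simp
  qed (use P(1,2) in \<open>auto intro: continuous_intros\<close>)
  show "riemannian_dist Z (snd p) (snd q) \<le> riemannian_dist (prod_riemannian Y Z) p q"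
  proof (rule riemannian_dist_project_le[OF _ bounded_linear_snd])
    fix \<psi> and x :: "'a \<times> 'c"
    assume \<psi>: "\<psi> \<in> atlas Z" "snd x \<in> fst \<psi>"
    then show "\<exists>\<eta>\<in>atlas (prod_riemannian Y Z). x \<in> fst \<eta> \<and> linear_lift snd snd \<eta> \<psi>"
      using DY(6)[of "fst x"]
      by (intro bexI[of _ "prod_chart (chart_at Y (fst x)) \<psi>"])
        (auto simp: P DY(5) prod_chart_def mem_Times_iff intro: P[unfolded prod_chart_def])
  next
    show "linear_lift snd snd (chart_at (prod_riemannian Y Z) x) (chart_at Z (snd x))" for x
      unfolding P(6) by (intro P(5) DY DZ)
    show "metric Z (snd x) (snd v) (snd v) \<le> metric (prod_riemannian Y Z) x v v" for x v
      unfolding metric using DY(4) by simp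
  qed (use P(1,2) in \<open>auto intro: continuous_intros\<close>)
qed

section \<open>Condition numbers of an output and of output and latent variable jointly\<close>

theorem proposition4:
  fixes X :: "('x::{t2_space, second_countable_topology}, 'a::{real_inner, heine_borel}) riemannian"
    and Y :: "('y::{t2_space, second_countable_topology}, 'b::{real_inner, heine_borel}) riemannian"
    and Z :: "('z::{t2_space, second_countable_topology}, 'd::{real_inner, heine_borel}) riemannian"
    and W :: "('w::{t2_space, second_countable_topology}, 'e::{real_inner, heine_borel}) manifold"
    and F :: "'x \<times> 'y \<times> 'z \<Rightarrow> 'w" and c :: 'w
    and x0 :: 'x and y0 :: 'y and z0 :: 'z
  assumes "CREP X Y Z W F c"
    and "riemannian_manifold X" and "riemannian_manifold Y" and "riemannian_manifold Z"
    and "F (x0, y0, z0) = c"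
  shows "\<exists>N. z0 \<in> interior N \<and>
    (\<forall>Zh. z0 \<in> interior Zh \<and> Zh \<subseteq> N \<longrightarrow>
      condition_number X Y F c x0 y0 Zh \<le> joint_condition_number X Y Z F c x0 y0 z0)"
proof (intro exI[of _ UNIV] conjI allI impI)
  show "z0 \<in> interior UNIV" by simp
  fix Zh assume "z0 \<in> interior Zh \<and> Zh \<subseteq> UNIV"
  then have Zh: "z0 \<in> interior Zh" by simp
  let ?J = "joint_condition_number X Y Z F c x0 y0 z0"
  let ?dX = "riemannian_dist X x0" and ?dY = "riemannian_dist Y y0"
    and ?dP = "riemannian_dist (prod_riemannian Y Z) (y0, z0)"
  define sol where "sol x = {p. F (x, fst p, snd p) = c}" for x
  define joint where "joint x = (INF p\<in>sol x. ?dP p / ?dX x)" for x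
  have J: "?J = Limsup (at x0) joint"
    unfolding joint_condition_number_def condition_number_def joint_def sol_def
    by (simp add: case_prod_beta)
  show "condition_number X Y F c x0 y0 Zh \<le> ?J"
  proof (cases "?J = \<infinity>")
    case False
    then obtain k where k: "0 < k" "?J < ennreal k"
      by (cases ?J) (auto intro!: that[of "enn2real ?J + 1"] simp: ennreal_less_iff)
    obtain \<epsilon> where \<epsilon>: "0 < \<epsilon>" "\<And>z. z \<notin> interior Zh \<Longrightarrow> ennreal \<epsilon> \<le> riemannian_dist Z z0 z"
      using riemannian_dist_bounded_below_outside[OF assms(4) open_interior Zh] by metis
    have "\<forall>\<^sub>F x in at x0. joint x < ennreal k"
      using k(2) Limsup_le_iff[of "at x0" joint ?J] J by auto
    moreover have "\<forall>\<^sub>F x in at x0. ?dX x < ennreal (\<epsilon> / k)"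
      using riemannian_dist_small_nearby[OF assms(2), of "\<epsilon> / k" x0] \<epsilon>(1) k(1)
      by (simp add: eventually_nhds_conv_at)
    ultimately have "\<forall>\<^sub>F x in at x0.
        (INF y\<in>{y. \<exists>z\<in>Zh. F (x, y, z) = c}. ?dY y / ?dX x) \<le> joint x"
    proof eventually_elim
      case (elim x)
      let ?I = "INF y\<in>{y. \<exists>z\<in>Zh. F (x, y, z) = c}. ?dY y / ?dX x"
      have close: "?I \<le> ?dP p / ?dX x" if p: "p \<in> sol x" "?dP p / ?dX x < ennreal k" for p
      proof -
        \<comment> \<open>If \<open>?dX x = 0\<close>, the quotient is \<open>0\<close> or \<open>\<infinity>\<close>, and being below \<open>k\<close> it is \<open>0\<close>.\<close>
        have "?dP p < ennreal \<epsilon>"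
        proof (cases "?dX x = 0")
          case True
          then show ?thesis using p(2) \<epsilon>(1) by (auto split: if_splits)
        next
          case False
          have "?dP p < ennreal k * ?dX x"
            using p(2) False elim(2)
            by (subst (asm) divide_less_ennreal) (auto intro: less_top_ennreal order.strict_trans)
          also have "\<dots> \<le> ennreal k * ennreal (\<epsilon> / k)"
            using elim(2) by (intro mult_left_mono) auto
          also have "\<dots> = ennreal \<epsilon>"
            using k(1) \<epsilon>(1) by (simp flip: ennreal_mult)
          finally show ?thesis .
        qed
        then have "riemannian_dist Z z0 (snd p) < ennreal \<epsilon>"
          using riemannian_dist_snd_le[OF assms(3,4), of "(y0, z0)" p] by simp
        then have "snd p \<in> Zh"
          using \<epsilon>(2)[of "snd p"] interior_subset[of Zh] by (meson not_le subsetD)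
        then have "?I \<le> ?dY (fst p) / ?dX x"
          using p(1) by (intro INF_lower) (cases p, auto simp: sol_def)
        also have "\<dots> \<le> ?dP p / ?dX x"
          using riemannian_dist_fst_le[OF assms(3,4), of "(y0, z0)" p]
          by (intro divide_right_mono_ennreal) simp
        finally show ?thesis .
      qed
      obtain q where q: "q \<in> sol x" "?dP q / ?dX x < ennreal k"
        using elim(1) unfolding joint_def INF_less_iff by blast
      \<comment> \<open>A solution whose quotient is at least \<open>k\<close> may have its latent variable outside \<open>Zh\<close>, but it is
        beaten by \<open>q\<close>.\<close>
      show ?case
        unfolding joint_def
      proof (rule INF_greatest)
        fix p assume p: "p \<in> sol x"
        show "?I \<le> ?dP p / ?dX x"
        proof (cases "?dP p / ?dX x < ennreal k")
          case False
          then show ?thesis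
            using close[OF q] q(2) by (simp add: not_less)
        qed (rule close[OF p])
      qed
    qed
    then show ?thesis
      unfolding J condition_number_def by (rule Limsup_mono)
  qed simp
qed

end
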